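(* Let $K$ be a nice simplicial complex and $\sigma_0$ a facet of $K$. The reduced group of projectivities $\Pi_0(K,\sigma_0)$ is generated by the projectivities around the odd codimension-$2$-faces of $K$. In particular, $\Pi_0(K,\sigma_0)$ is generated by transpositions.
   Context: $K$ is a locally finite simplicial complex that is pure of dimension $d$ (every face lies in a $d$-dimensional face); it is identified with its geometric realization. Faces are non-empty simplices; $d$-dimensional faces are facets, codimension-$1$ faces are ridges; two distinct facets are neighbors if they share a ridge. $V(\sigma)$ is the vertex set of $\sigma$. A pure complex is strongly connected if any two facets are joined by a sequence of consecutively neighboring facets. The star $\operatorname{st}\kappa$ of a face $\kappa$ is the subcomplex of all faces of simplices containing $\kappa$, and $\operatorname{lk}\kappa$ is its link. $K$ is locally strongly connected if the star of each face is strongly connected; locally strongly simply connected if for each face $\kappa$ with $\operatorname{codim}\kappa>2$ the link $\operatorname{lk}\kappa$ is simply connected; nice if it is both. Projectivities. For neighboring facets $\sigma,\tau$ the perspectivity $\langle\sigma,\tau\rangle:V(\sigma)\to V(\tau)$ is the bijection fixing all common vertices and sending the vertex of $\sigma$ not in $\tau$ to the vertex of $\tau$ not in $\sigma$. A facet path is a sequence $\gamma=(\sigma_0,\dots,\sigma_n)$ of facets with consecutive ones neighbors; its projectivity is $\langle\gamma\rangle=\langle\sigma_0,\sigma_1\rangle\cdots\langle\sigma_{n-1},\sigma_n\rangle$ (maps written on the right: $fg$ means first $f$, then $g$). The inverse path is $\gamma^-=(\sigma_n,\dots,\sigma_0)$. If $\sigma_n=\sigma_0$, $\gamma$ is a facet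 loop based at $\sigma_0$. The group of projectivities $\Pi(K,\sigma_0)\le\operatorname{Sym}(V(\sigma_0))$ consists of the projectivities along all facet loops based at $\sigma_0$. A facet path induces a piecewise linear path in $K$ by joining the barycenter of each facet $\sigma_i$ linearly to the barycenters of the ridges $\sigma_i\cap\sigma_{i\pm1}$; a facet loop is null-homotopic if the induced loop is. $\Pi_0(K,\sigma_0)\le\Pi(K,\sigma_0)$ consists of the projectivities along null-homotopic facet loops based at $\sigma_0$. The link of a codimension-$2$-face $\kappa$ is a graph; $\kappa$ is even if this graph is bipartite and odd otherwise. A projectivity around a codimension-$2$-face $\kappa$ is a projectivity $\langle g l g^-\rangle$, where $g$ is a facet path from $\sigma_0$ to some facet $\sigma\supset\kappa$ and $l$ is a facet loop in $\operatorname{st}\kappa$ based at $\sigma$. *)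

theory Defs
  imports "HOL-Analysis.Analysis" "HOL-Algebra.Bij" "HOL-Algebra.Generated_Groups"
    "HOL-Combinatorics.Transposition"
begin

section \<open>Simplicial complexes\<close>

text \<open>A face is identified with its vertex set; faces are non-empty.  The vertices of
  \<open>K\<close> are the elements of \<open>\<Union>K\<close>.  (The constant \<open>simplicial_complex\<close> of HOL-Analysis is
  about finite complexes in a Euclidean space.)\<close>

definition abstract_complex :: "'a set set \<Rightarrow> bool" where
  "abstract_complex K \<longleftrightarrow>
     (\<forall>\<sigma>\<in>K. finite \<sigma> \<and> \<sigma> \<noteq> {}) \<and> (\<forall>\<sigma>\<in>K. \<forall>\<tau>. \<tau> \<subseteq> \<sigma> \<and> \<tau> \<noteq> {} \<longrightarrow> \<tau> \<in> K)"

definition locally_finite_complex :: "'a set set \<Rightarrow> bool" where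
  "locally_finite_complex K \<longleftrightarrow> (\<forall>v\<in>\<Union>K. finite {\<sigma>\<in>K. v \<in> \<sigma>})"

definition face_dim :: "'a set \<Rightarrow> nat" where
  "face_dim \<sigma> = card \<sigma> - 1"

text \<open>The codimension in a complex that is pure of dimension \<open>d\<close>; there no face has dimension
  greater than \<open>d\<close>, so the subtraction is not truncated.\<close>

definition codim :: "nat \<Rightarrow> 'a set \<Rightarrow> nat" where
  "codim d \<sigma> = d - face_dim \<sigma>"

definition facets :: "nat \<Rightarrow> 'a set set \<Rightarrow> 'a set set" where
  "facets d K = {\<sigma>\<in>K. face_dim \<sigma> = d}"

definition pure_complex :: "nat \<Rightarrow> 'a set set \<Rightarrow> bool" where
  "pure_complex d K \<longleftrightarrow> (\<forall>\<sigma>\<in>K. \<exists>\<tau>\<in>facets d K. \<sigma> \<subseteq> \<tau>)"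

definition star :: "'a set set \<Rightarrow> 'a set \<Rightarrow> 'a set set" where
  "star K \<kappa> = {\<rho>\<in>K. \<exists>\<sigma>\<in>K. \<kappa> \<subseteq> \<sigma> \<and> \<rho> \<subseteq> \<sigma>}"

definition link :: "'a set set \<Rightarrow> 'a set \<Rightarrow> 'a set set" where
  "link K \<kappa> = {\<rho>\<in>K. \<rho> \<inter> \<kappa> = {} \<and> \<rho> \<union> \<kappa> \<in> K}"


section \<open>Facet paths and strong connectivity\<close>

definition neighbors :: "nat \<Rightarrow> 'a set set \<Rightarrow> 'a set \<Rightarrow> 'a set \<Rightarrow> bool" where
  "neighbors d K \<sigma> \<tau> \<longleftrightarrow> \<sigma> \<in> facets d K \<and> \<tau> \<in> facets d K \<and> \<sigma> \<noteq> \<tau> \<and>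
     (\<exists>\<rho>\<in>K. codim d \<rho> = 1 \<and> \<rho> \<subseteq> \<sigma> \<and> \<rho> \<subseteq> \<tau>)"

definition facet_path :: "nat \<Rightarrow> 'a set set \<Rightarrow> 'a set list \<Rightarrow> bool" where
  "facet_path d K \<gamma> \<longleftrightarrow> \<gamma> \<noteq> [] \<and> set \<gamma> \<subseteq> facets d K \<and> successively (neighbors d K) \<gamma>"

definition facet_loop :: "nat \<Rightarrow> 'a set set \<Rightarrow> 'a set \<Rightarrow> 'a set list \<Rightarrow> bool" where
  "facet_loop d K \<sigma> \<gamma> \<longleftrightarrow> facet_path d K \<gamma> \<and> hd \<gamma> = \<sigma> \<and> last \<gamma> = \<sigma>"

definition strongly_connected :: "nat \<Rightarrow> 'a set set \<Rightarrow> bool" where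
  "strongly_connected d K \<longleftrightarrow>
     (\<forall>\<sigma>\<in>facets d K. \<forall>\<tau>\<in>facets d K. \<exists>\<gamma>. facet_path d K \<gamma> \<and> hd \<gamma> = \<sigma> \<and> last \<gamma> = \<tau>)"

definition locally_strongly_connected :: "nat \<Rightarrow> 'a set set \<Rightarrow> bool" where
  "locally_strongly_connected d K \<longleftrightarrow> (\<forall>\<kappa>\<in>K. strongly_connected d (star K \<kappa>))"


section \<open>Geometric realization\<close>

text \<open>Points are given by their barycentric coordinates, and the realization is a subspace of the
  product space of all functions from vertices to reals.  For a locally finite complex this is the
  usual (coherent) topology; see \<open>openin_realization_iff\<close> below.\<close>

definition closed_simplex :: "'a set \<Rightarrow> ('a \<Rightarrow> real) set" where
  "closed_simplex \<sigma> = {x. (\<forall>v. 0 \<le> x v) \<and> (\<forall>v. v \<notin> \<sigma> \<longrightarrow> x v = 0) \<and> (\<Sum>v\<in>\<sigma>. x v) = 1}"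

definition realization :: "'a set set \<Rightarrow> ('a \<Rightarrow> real) set" where
  "realization K = (\<Union>\<sigma>\<in>K. closed_simplex \<sigma>)"

lemma openin_realization_iff:
  fixes K :: "'a set set"
  assumes K: "abstract_complex K" "locally_finite_complex K" and U: "U \<subseteq> realization K"
  shows "openin (top_of_set (realization K)) U \<longleftrightarrow>
    (\<forall>\<sigma>\<in>K. openin (top_of_set (closed_simplex \<sigma>)) (U \<inter> closed_simplex \<sigma>))"
proof
  assume "openin (top_of_set (realization K)) U"
  then obtain W where "open W" "U = realization K \<inter> W"
    by (auto simp: openin_open)
  then show "\<forall>\<sigma>\<in>K. openin (top_of_set (closed_simplex \<sigma>)) (U \<inter> closed_simplex \<sigma>)"
    unfolding openin_open realization_def by blast
next
  assume "\<forall>\<sigma>\<in>K. openin (top_of_set (closed_simplex \<sigma>)) (U \<inter> closed_simplex \<sigma>)"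
  then have "\<forall>\<sigma>\<in>K. \<exists>W. open W \<and> U \<inter> closed_simplex \<sigma> = closed_simplex \<sigma> \<inter> W"
    by (simp add: openin_open)
  then obtain W where W: "\<And>\<sigma>. \<sigma> \<in> K \<Longrightarrow> open (W \<sigma>)"
    "\<And>\<sigma>. \<sigma> \<in> K \<Longrightarrow> U \<inter> closed_simplex \<sigma> = closed_simplex \<sigma> \<inter> W \<sigma>"
    by metis
  show "openin (top_of_set (realization K)) U"
  proof (subst openin_subopen, intro ballI)
    fix x assume xU: "x \<in> U"
    define S where "S = {v. x v \<noteq> 0}"
    obtain \<sigma>0 where \<sigma>0: "\<sigma>0 \<in> K" "x \<in> closed_simplex \<sigma>0"
      using xU U by (auto simp: realization_def)
    have S\<sigma>0: "S \<subseteq> \<sigma>0"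
      using \<sigma>0(2) by (auto simp: closed_simplex_def S_def)
    moreover have "finite \<sigma>0"
      using \<sigma>0(1) K(1) by (simp add: abstract_complex_def)
    ultimately have fS: "finite S"
      by (rule finite_subset)
    have pos: "x v > 0" if "v \<in> S" for v
      using that \<sigma>0(2) by (auto simp: closed_simplex_def S_def order_less_le)
    have sum0: "(\<Sum>v\<in>\<sigma>0. x v) = (\<Sum>v\<in>S. x v)"
      using S\<sigma>0 \<sigma>0(1) K(1)
      by (intro sum.mono_neutral_right) (auto simp: abstract_complex_def S_def)
    then have "S \<noteq> {}"
      using \<sigma>0(2) by (auto simp: closed_simplex_def)
    then obtain v0 where v0: "v0 \<in> S" by blast
    define F where "F = {\<sigma>\<in>K. S \<subseteq> \<sigma>}"
    have "finite {\<sigma>\<in>K. v0 \<in> \<sigma>}"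
      using K(2) v0 S\<sigma>0 \<sigma>0(1) by (auto simp: locally_finite_complex_def)
    then have fF: "finite F"
      by (rule rev_finite_subset) (use v0 in \<open>auto simp: F_def\<close>)
    have sumS: "(\<Sum>v\<in>\<sigma>. x v) = 1" if "\<sigma> \<in> F" for \<sigma>
    proof -
      have "(\<Sum>v\<in>\<sigma>. x v) = (\<Sum>v\<in>S. x v)"
        using that K(1)
        by (intro sum.mono_neutral_right) (auto simp: abstract_complex_def S_def F_def)
      then show ?thesis using sum0 \<sigma>0(2) by (simp add: closed_simplex_def)
    qed
    have xF: "x \<in> closed_simplex \<sigma>" if "\<sigma> \<in> F" for \<sigma>
      using sumS[OF that] that \<sigma>0(2) by (auto simp: closed_simplex_def F_def S_def)
    define N where "N = (\<Inter>v\<in>S. {y. (y::'a \<Rightarrow> real) v > 0}) \<inter> (\<Inter>\<sigma>\<in>F. W \<sigma>)"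
    have cont: "continuous_on UNIV (\<lambda>y::'a \<Rightarrow> real. y v)" for v
      by (rule continuous_on_product_coordinates)
    have "open N"
      unfolding N_def using fS fF W(1)
      by (intro open_Int open_INT ballI open_Collect_less continuous_on_const cont)
        (auto simp: F_def)
    moreover have "x \<in> N"
      using pos xF W(2) xU unfolding N_def F_def by blast
    moreover have "realization K \<inter> N \<subseteq> U"
    proof
      fix y assume y: "y \<in> realization K \<inter> N"
      then obtain \<tau> where \<tau>: "\<tau> \<in> K" "y \<in> closed_simplex \<tau>"
        by (auto simp: realization_def)
      have "S \<subseteq> \<tau>"
      proof
        fix v assume "v \<in> S"
        then have "y v > 0" using y by (simp add: N_def)
        then show "v \<in> \<tau>" using \<tau>(2) by (force simp: closed_simplex_def)
      qed
      then have "\<tau> \<in> F" using \<tau>(1) by (simp add: F_def)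
      then show "y \<in> U" using y W(2)[OF \<tau>(1)] \<tau>(2) by (auto simp: N_def)
    qed
    moreover have "x \<in> realization K" using xU U by blast
    ultimately show "\<exists>T. openin (top_of_set (realization K)) T \<and> x \<in> T \<and> T \<subseteq> U"
      unfolding openin_open by blast
  qed
qed

definition locally_strongly_simply_connected :: "nat \<Rightarrow> 'a set set \<Rightarrow> bool" where
  "locally_strongly_simply_connected d K \<longleftrightarrow>
     (\<forall>\<kappa>\<in>K. codim d \<kappa> > 2 \<longrightarrow> simply_connected (realization (link K \<kappa>)))"

definition nice_complex :: "nat \<Rightarrow> 'a set set \<Rightarrow> bool" where
  "nice_complex d K \<longleftrightarrow> locally_strongly_connected d K \<and> locally_strongly_simply_connected d K"

definition barycenter :: "'a set \<Rightarrow> 'a \<Rightarrow> real" where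
  "barycenter \<sigma> = (\<lambda>v. if v \<in> \<sigma> then 1 / real (card \<sigma>) else 0)"

text \<open>The library's \<open>linepath\<close> needs a normed space, which a function space is not.\<close>

definition segment_path :: "('a \<Rightarrow> real) \<Rightarrow> ('a \<Rightarrow> real) \<Rightarrow> real \<Rightarrow> ('a \<Rightarrow> real)" where
  "segment_path p q = (\<lambda>t v. (1 - t) * p v + t * q v)"

text \<open>The piecewise linear path induced by a facet path.  It ends with a constant piece, which is
  irrelevant up to homotopy.\<close>

fun induced_path :: "'a set list \<Rightarrow> real \<Rightarrow> ('a \<Rightarrow> real)" where
  "induced_path [] = undefined"
| "induced_path [\<sigma>] = (\<lambda>_. barycenter \<sigma>)"
| "induced_path (\<sigma> # \<tau> # \<gamma>) =
     segment_path (barycenter \<sigma>) (barycenter (\<sigma> \<inter> \<tau>)) +++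
     segment_path (barycenter (\<sigma> \<inter> \<tau>)) (barycenter \<tau>) +++
     induced_path (\<tau> # \<gamma>)"

definition null_homotopic_facet_loop :: "nat \<Rightarrow> 'a set set \<Rightarrow> 'a set \<Rightarrow> 'a set list \<Rightarrow> bool" where
  "null_homotopic_facet_loop d K \<sigma> \<gamma> \<longleftrightarrow> facet_loop d K \<sigma> \<gamma> \<and>
     homotopic_paths (realization K) (induced_path \<gamma>) (\<lambda>_. barycenter \<sigma>)"


section \<open>Projectivities\<close>

text \<open>Maps on \<open>V(\<sigma>)\<close> are extensional, as in \<^const>\<open>BijGroup\<close>, which serves as the symmetric
  group.  Its product is \<open>\<lambda>g f. g \<circ> f\<close>, the opposite of the composition from left to right that
  is customary for projectivities; generated subgroups are the same for both.\<close>

definition perspectivity :: "'a set \<Rightarrow> 'a set \<Rightarrow> 'a \<Rightarrow> 'a" where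
  "perspectivity \<sigma> \<tau> = (\<lambda>v\<in>\<sigma>. if v \<in> \<tau> then v else (THE w. w \<in> \<tau> - \<sigma>))"

fun projectivity :: "'a set list \<Rightarrow> 'a \<Rightarrow> 'a" where
  "projectivity [] = undefined"
| "projectivity [\<sigma>] = (\<lambda>v\<in>\<sigma>. v)"
| "projectivity (\<sigma> # \<tau> # \<gamma>) = compose \<sigma> (projectivity (\<tau> # \<gamma>)) (perspectivity \<sigma> \<tau>)"

definition reduced_projectivities :: "nat \<Rightarrow> 'a set set \<Rightarrow> 'a set \<Rightarrow> ('a \<Rightarrow> 'a) set" where
  "reduced_projectivities d K \<sigma>0 = {projectivity \<gamma> |\<gamma>. null_homotopic_facet_loop d K \<sigma>0 \<gamma>}"

definition bipartite_graph :: "'a set set \<Rightarrow> bool" where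
  "bipartite_graph L \<longleftrightarrow> (\<exists>A B. A \<union> B = \<Union>L \<and> A \<inter> B = {} \<and>
     (\<forall>u v. {u, v} \<in> L \<and> u \<noteq> v \<longrightarrow> (u \<in> A \<and> v \<in> B) \<or> (u \<in> B \<and> v \<in> A)))"

definition odd_face :: "'a set set \<Rightarrow> 'a set \<Rightarrow> bool" where
  "odd_face K \<kappa> \<longleftrightarrow> \<not> bipartite_graph (link K \<kappa>)"

text \<open>The list below is the concatenation \<open>g l g\<^sup>-\<close>, in which the common end facets occur once.\<close>

definition projectivities_around ::
    "nat \<Rightarrow> 'a set set \<Rightarrow> 'a set \<Rightarrow> 'a set \<Rightarrow> ('a \<Rightarrow> 'a) set" where
  "projectivities_around d K \<sigma>0 \<kappa> =
     {projectivity (g @ tl l @ tl (rev g)) |g l.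
        facet_path d K g \<and> hd g = \<sigma>0 \<and> \<kappa> \<subseteq> last g \<and> facet_loop d (star K \<kappa>) (last g) l}"

definition transpositions :: "'a set \<Rightarrow> ('a \<Rightarrow> 'a) set" where
  "transpositions S = {restrict (Transposition.transpose a b) S |a b. a \<in> S \<and> b \<in> S \<and> a \<noteq> b}"

end

theory Submission
  imports Defs
begin

text \<open>Write \<open>N\<close> for the group generated by the projectivities around the odd faces of codimension two, and
\<open>\<langle>g\<rangle>\<close> for the projectivity of \<open>g\<close>; maps are composed from right to left.

That \<open>N\<close> lies in the reduced group is the easy inclusion.  A facet loop in the star of \<open>\<kappa>\<close> can be
contracted linearly to the barycenter of \<open>\<kappa>\<close> (\<open>null_homotopic_star_loop\<close>), so all projectivities
around \<open>\<kappa>\<close> come from null-homotopic loops, and those form a group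
(\<open>reduced_projectivities_subgroup\<close>).

The other inclusion is a monodromy argument.  To each facet \<open>\<sigma>\<close> attach the cosets \<open>\<langle>g\<rangle> \<circ> N\<close>, where \<open>g\<close> runs
over the facet paths from \<open>\<sigma>0\<close> to \<open>\<sigma>\<close>, and let perspectivities act on them by composition.  This is a
local system on the facets (locale \<open>facet_transport\<close>), a combinatorial covering.  Transport around
a face is trivial in codimension at most two: a loop around a face of codimension at most one has
trivial projectivity; around an even face the two colours of the link are preserved, which again
makes the projectivity trivial; and around an odd face the projectivity is absorbed by \<open>N\<close>
(\<open>flat_cosets\<close>).  If transport along every null-homotopic loop \<open>\<gamma>\<close> is trivial as well, then
\<open>\<langle>\<gamma>\<rangle> \<circ> N = N\<close>, which means \<open>\<langle>\<gamma>\<rangle> \<in> N\<close>.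

It remains to pass from loops around small faces to null-homotopic loops, for an arbitrary local
system.  There are two steps.

\<^item> Assume that transport is trivial in the star of every vertex.  A homotopy is cut into a grid so
fine that each cell is mapped into the open star of one vertex.  Neighboring cells have vertices
in a common face, and since the stars of edges are strongly connected, transport in the stars of
the two vertices agrees where both are defined.  So transport along a row of the grid does not
change from one row to the next (\<open>lift_ends_agree\<close>, \<open>transport_null_homotopic\<close>).

\<^item> Triviality in the star of every vertex follows from triviality in codimension at most two by
induction on the codimension of the face \<open>\<kappa>\<close> (\<open>flat_at_from_link\<close>).  In codimension greater than two
the link of \<open>\<kappa>\<close> is simply connected.  Its facet loops, which correspond to those in the star of \<open>\<kappa>\<close>,
are therefore null-homotopic in the link; and the
star of a vertex of the link corresponds to the star of a larger face of \<open>K\<close>, where transport is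
trivial by induction.  Hence the first step applies to the link.

For the last claim, a loop in the star of a codimension-two face fixes the face and permutes the two
remaining vertices, so the generators are transpositions or trivial
(\<open>projectivities_around_transpositions\<close>).\<close>

section \<open>Homotopies in arbitrary topological spaces\<close>

text \<open>The realization lives in a function space, where the group laws for homotopy classes of paths are
wanted without a norm.  They follow from the normed case: both sides of such a law are images,
under one continuous map, of paths in a convex set with the same ends.\<close>

lemma homotopic_paths_through_convex:
  fixes D :: "'c::real_normed_vector set" and h :: "'c \<Rightarrow> 'b::topological_space"
  assumes D: "convex D" and h: "continuous_on D h" "h \<in> D \<rightarrow> S"
    and p: "path p" "path_image p \<subseteq> D" and q: "path q" "path_image q \<subseteq> D"
    and ends: "pathstart p = pathstart q" "pathfinish p = pathfinish q"
  shows "homotopic_paths S (h \<circ> p) (h \<circ> q)"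
proof (rule homotopic_paths_continuous_image[OF _ h])
  show "homotopic_paths D p q"
    using convex_imp_simply_connected[OF D] p q ends
    by (simp add: simply_connected_eq_homotopic_paths)
qed

lemma homotopic_paths_join_const:
  assumes p: "path p" "path_image p \<subseteq> S"
  shows "homotopic_paths S (p +++ (\<lambda>_. pathfinish p)) p"
    and "homotopic_paths S ((\<lambda>_. pathstart p) +++ p) p"
proof -
  have c: "continuous_on {0..1} p" "p \<in> {0..1} \<rightarrow> S"
    using p by (auto simp: path_def path_image_def)
  have "homotopic_paths S (p \<circ> (linepath 0 1 +++ linepath 1 1)) (p \<circ> linepath 0 1)"
    by (rule homotopic_paths_through_convex[OF convex_real_interval(5) c])
       (auto simp: path_image_join closed_segment_eq_real_ivl)
  then show "homotopic_paths S (p +++ (\<lambda>_. pathfinish p)) p"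
    by (simp add: path_compose_join) (simp add: o_def linepath_def pathfinish_def)
  have "homotopic_paths S (p \<circ> (linepath 0 0 +++ linepath 0 1)) (p \<circ> linepath 0 1)"
    by (rule homotopic_paths_through_convex[OF convex_real_interval(5) c])
       (auto simp: path_image_join closed_segment_eq_real_ivl)
  then show "homotopic_paths S ((\<lambda>_. pathstart p) +++ p) p"
    by (simp add: path_compose_join) (simp add: o_def linepath_def pathstart_def)
qed

lemma homotopic_paths_back_and_forth:
  assumes p: "path p" "path_image p \<subseteq> S"
  shows "homotopic_paths S (p +++ reversepath p) (\<lambda>_. pathstart p)"
proof -
  have c: "continuous_on {0..1} p" "p \<in> {0..1} \<rightarrow> S"
    using p by (auto simp: path_def path_image_def)
  have "homotopic_paths S (p \<circ> (linepath 0 1 +++ linepath 1 0)) (p \<circ> linepath 0 0)"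
    by (rule homotopic_paths_through_convex[OF convex_real_interval(5) c])
       (auto simp: path_image_join closed_segment_eq_real_ivl)
  then show ?thesis
    by (simp add: path_compose_join) (simp add: o_def linepath_def pathstart_def reversepath_def)
qed

text \<open>A free contraction of \<open>p\<close> is a map of the square.  Going around the other three sides of the square
means following the track \<open>q\<close> of the base point, resting at \<open>a\<close>, and returning along \<open>q\<close>.\<close>

lemma homotopic_loops_const_imp_homotopic_paths:
  assumes "homotopic_loops S p (\<lambda>_. a)"
  shows "homotopic_paths S p (\<lambda>_. pathstart p)"
proof -
  let ?I = "{0..1::real}"
  obtain h where h: "continuous_on (?I \<times> ?I) h" "h \<in> (?I \<times> ?I) \<rightarrow> S"
    and h0: "\<And>x. x \<in> ?I \<Longrightarrow> h (0,x) = p x" and h1: "\<And>x. x \<in> ?I \<Longrightarrow> h (1,x) = a"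
    and ends: "\<And>t. t \<in> ?I \<Longrightarrow> h (t,1) = h (t,0)"
    using assms by (force simp: homotopic_loops pathstart_def pathfinish_def)
  have pp: "path p" "path_image p \<subseteq> S"
    using homotopic_loops_imp_path[OF assms] homotopic_loops_imp_subset[OF assms] by auto
  define q where "q = h \<circ> linepath (0,0) (1,0)"
  have lin: "path_image (linepath u v) \<subseteq> ?I \<times> ?I" if "u \<in> ?I \<times> ?I" "v \<in> ?I \<times> ?I" for u v :: "real \<times> real"
    using that closed_segment_subset[of u "?I \<times> ?I" v] by (simp add: convex_Times)
  let ?r = "linepath (0,0) (1,0) +++ linepath (1,0) (1,1) +++ linepath (1,1) (0,1::real)"
  have r: "path ?r" "path_image ?r \<subseteq> ?I \<times> ?I"
    by simp (intro subset_path_image_join lin; simp)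
  have "homotopic_paths S (h \<circ> linepath (0,0) (0,1)) (h \<circ> ?r)"
  proof (rule homotopic_paths_through_convex[OF _ h _ _ r])
    show "path_image (linepath (0,0) (0,1)) \<subseteq> ?I \<times> ?I" by (rule lin) auto
  qed (auto simp: convex_Times)
  moreover have "homotopic_paths S p (h \<circ> linepath (0,0) (0,1))"
    by (rule homotopic_paths_eq[OF pp]) (auto simp: linepath_def h0)
  moreover have sides: "homotopic_paths S
      (h \<circ> ?r)
      (q \<circ> (linepath 0 1 +++ linepath 1 1 +++ linepath 1 0))"
  proof (rule homotopic_paths_eq)
    show "path (h \<circ> ?r)"
      by (rule path_continuous_image[OF r(1) continuous_on_subset[OF h(1) r(2)]])
    show "path_image (h \<circ> ?r) \<subseteq> S"
      using r(2) h(2) by (auto simp: path_image_compose Pi_iff)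
    fix t :: real assume t: "t \<in> {0..1}"
    show "(h \<circ> ?r) t = (q \<circ> (linepath 0 1 +++ linepath 1 1 +++ linepath 1 0)) t"
      using t by (auto simp: joinpaths_def q_def linepath_def h1 ends algebra_simps)
  qed
  moreover have q: "continuous_on ?I q" "q \<in> ?I \<rightarrow> S"
  proof -
    have "path (linepath (0,0) (1,0::real))" "path_image (linepath (0,0) (1,0::real)) \<subseteq> ?I \<times> ?I"
      by simp (rule lin; simp)
    then have "path q" unfolding q_def using h(1)
      by (metis path_continuous_image continuous_on_subset)
    then show "continuous_on ?I q" by (simp add: path_def)
    show "q \<in> ?I \<rightarrow> S" using h(2) by (auto simp: q_def linepath_def Pi_iff)
  qed
  have "homotopic_paths S (q \<circ> (linepath 0 1 +++ linepath 1 1 +++ linepath 1 0)) (q \<circ> linepath 0 0)"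
    by (rule homotopic_paths_through_convex[OF convex_real_interval(5) q])
       (auto simp: path_image_join closed_segment_eq_real_ivl)
  moreover have "q \<circ> linepath 0 0 = (\<lambda>_. pathstart p)"
    using h0[of 0] by (simp add: q_def linepath_def o_def pathstart_def)
  ultimately show ?thesis
    by (metis homotopic_paths_trans)
qed

section \<open>Facets and facet paths\<close>

lemma facets_iff:
  assumes "abstract_complex K"
  shows "\<sigma> \<in> facets d K \<longleftrightarrow> \<sigma> \<in> K \<and> card \<sigma> = Suc d"
proof -
  have "card \<sigma> > 0" if "\<sigma> \<in> K"
    using that assms unfolding abstract_complex_def card_gt_0_iff by metis
  then show ?thesis by (auto simp: facets_def face_dim_def)
qed

lemma finite_face: "abstract_complex K \<Longrightarrow> \<sigma> \<in> K \<Longrightarrow> finite \<sigma>"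
  unfolding abstract_complex_def by blast

lemma subface: "abstract_complex K \<Longrightarrow> \<sigma> \<in> K \<Longrightarrow> \<rho> \<subseteq> \<sigma> \<Longrightarrow> \<rho> \<noteq> {} \<Longrightarrow> \<rho> \<in> K"
  unfolding abstract_complex_def by blast

lemma card_face_le:
  assumes "abstract_complex K" "pure_complex d K" "\<sigma> \<in> K"
  shows "card \<sigma> \<le> Suc d"
proof -
  obtain \<tau> where "\<tau> \<in> facets d K" "\<sigma> \<subseteq> \<tau>"
    using assms by (auto simp: pure_complex_def)
  then show ?thesis
    using card_mono[of \<tau> \<sigma>] facets_iff[OF assms(1)] finite_face[OF assms(1)] by auto
qed

lemma neighbors_iff:
  assumes K: "abstract_complex K"
  shows "neighbors d K \<sigma> \<tau> \<longleftrightarrow> \<sigma> \<in> facets d K \<and> \<tau> \<in> facets d K \<and> card (\<sigma> \<inter> \<tau>) = d \<and> d > 0"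
proof
  assume n: "neighbors d K \<sigma> \<tau>"
  then obtain \<rho> where \<rho>: "\<rho> \<in> K" "codim d \<rho> = 1" "\<rho> \<subseteq> \<sigma> \<inter> \<tau>"
    and st: "\<sigma> \<in> facets d K" "\<tau> \<in> facets d K" "\<sigma> \<noteq> \<tau>"
    by (auto simp: neighbors_def)
  have fin: "finite \<sigma>" "finite \<tau>" "card \<sigma> = Suc d" "card \<tau> = Suc d"
    using st facets_iff[OF K] finite_face[OF K] by auto
  have "card \<rho> > 0" using \<rho>(1) K unfolding abstract_complex_def card_gt_0_iff by blast
  then have "card \<rho> = d" "d > 0" using \<rho>(2) by (auto simp: codim_def face_dim_def)
  moreover have "card \<rho> \<le> card (\<sigma> \<inter> \<tau>)" using \<rho>(3) fin by (intro card_mono) auto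
  moreover have "\<sigma> \<inter> \<tau> \<subset> \<sigma>"
    using st(3) fin by (metis Int_lower1 Int_lower2 card_subset_eq psubsetI)
  then have "card (\<sigma> \<inter> \<tau>) < Suc d" using psubset_card_mono fin by metis
  ultimately show "\<sigma> \<in> facets d K \<and> \<tau> \<in> facets d K \<and> card (\<sigma> \<inter> \<tau>) = d \<and> d > 0"
    using st by auto
next
  assume a: "\<sigma> \<in> facets d K \<and> \<tau> \<in> facets d K \<and> card (\<sigma> \<inter> \<tau>) = d \<and> d > 0"
  then have "\<sigma> \<inter> \<tau> \<noteq> {}" by auto
  then have "\<sigma> \<inter> \<tau> \<in> K" using a K by (meson Int_lower1 facets_iff subface)
  moreover have "codim d (\<sigma> \<inter> \<tau>) = 1" using a by (auto simp: codim_def face_dim_def)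
  moreover have "\<sigma> \<noteq> \<tau>" using a facets_iff[OF K, of \<sigma> d] by (metis inf.idem n_not_Suc_n)
  ultimately show "neighbors d K \<sigma> \<tau>" using a unfolding neighbors_def by (metis Int_lower1 Int_lower2)
qed

lemma neighbors_sym: "neighbors d K \<sigma> \<tau> \<Longrightarrow> neighbors d K \<tau> \<sigma>"
  by (auto simp: neighbors_def)

lemma facet_path_single [simp]: "facet_path d K [\<sigma>] \<longleftrightarrow> \<sigma> \<in> facets d K"
  by (simp add: facet_path_def)

lemma facet_path_Cons [simp]:
  "facet_path d K (\<sigma> # \<tau> # \<gamma>) \<longleftrightarrow> neighbors d K \<sigma> \<tau> \<and> facet_path d K (\<tau> # \<gamma>)"
  by (auto simp: facet_path_def neighbors_def)

lemma not_facet_path_Nil [simp]: "\<not> facet_path d K []"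
  by (simp add: facet_path_def)

text \<open>Concatenation of paths that share an end facet, which is listed only once.\<close>

lemma facet_path_append:
  assumes "facet_path d K \<alpha>" "facet_path d K \<beta>" "last \<alpha> = hd \<beta>"
  shows "facet_path d K (\<alpha> @ tl \<beta>)"
  using assms
proof (induction \<alpha> rule: induced_path.induct)
  case (2 \<sigma>) then show ?case by (cases \<beta>) auto
next
  case (3 \<sigma> \<tau> \<gamma>) then show ?case by auto
qed auto

lemma hd_last_append_tl:
  assumes "\<alpha> \<noteq> []" "\<beta> \<noteq> []" "last \<alpha> = hd \<beta>"
  shows "hd (\<alpha> @ tl \<beta>) = hd \<alpha>" "last (\<alpha> @ tl \<beta>) = last \<beta>"
  using assms by (cases \<beta>; auto simp: last_append)+

lemma facet_path_rev: "facet_path d K \<gamma> \<Longrightarrow> facet_path d K (rev \<gamma>)"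
  unfolding facet_path_def successively_rev
  by (auto elim: successively_mono intro: neighbors_sym)

lemma facet_path_nonempty: "facet_path d K \<gamma> \<Longrightarrow> \<gamma> \<noteq> []"
  by (simp add: facet_path_def)

lemma hd_facet: "facet_path d K \<gamma> \<Longrightarrow> hd \<gamma> \<in> facets d K"
  and last_facet: "facet_path d K \<gamma> \<Longrightarrow> last \<gamma> \<in> facets d K"
  by (auto simp: facet_path_def)

lemma nonempty_face: "abstract_complex K \<Longrightarrow> \<sigma> \<in> K \<Longrightarrow> \<sigma> \<noteq> {}"
  unfolding abstract_complex_def by blast

lemma abstract_complexI:
  assumes "\<And>\<sigma>. \<sigma> \<in> K \<Longrightarrow> finite \<sigma>" "\<And>\<sigma>. \<sigma> \<in> K \<Longrightarrow> \<sigma> \<noteq> {}"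
    "\<And>\<sigma> \<tau>. \<sigma> \<in> K \<Longrightarrow> \<tau> \<subseteq> \<sigma> \<Longrightarrow> \<tau> \<noteq> {} \<Longrightarrow> \<tau> \<in> K"
  shows "abstract_complex K"
  unfolding abstract_complex_def by (intro conjI ballI allI impI) (use assms in auto)

lemma abstract_complex_star:
  assumes K: "abstract_complex K" shows "abstract_complex (star K \<kappa>)"
proof (rule abstract_complexI)
  fix \<sigma> \<tau> assume \<sigma>: "\<sigma> \<in> star K \<kappa>" and \<tau>: "\<tau> \<subseteq> \<sigma>" "\<tau> \<noteq> {}"
  then have "\<sigma> \<in> K" by (simp add: star_def)
  then have "\<tau> \<in> K" using subface[OF K] \<tau> by simp
  then show "\<tau> \<in> star K \<kappa>" using \<sigma> \<tau> unfolding star_def mem_Collect_eq by (meson order_trans)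
qed (auto simp: star_def finite_face[OF K] nonempty_face[OF K])

text \<open>A face of full dimension that lies in a simplex containing \<open>\<kappa>\<close> must be this simplex.\<close>

lemma facets_star:
  assumes K: "abstract_complex K" "pure_complex d K"
  shows "facets d (star K \<kappa>) = {\<sigma> \<in> facets d K. \<kappa> \<subseteq> \<sigma>}"
proof -
  have "\<rho> = \<sigma>" if "\<rho> \<in> K" "card \<rho> = Suc d" "\<sigma> \<in> K" "\<rho> \<subseteq> \<sigma>" for \<rho> \<sigma>
    using that card_face_le[OF K that(3)] finite_face[OF K(1) that(3)] by (intro card_seteq) auto
  then have "\<sigma> \<in> star K \<kappa> \<longleftrightarrow> \<kappa> \<subseteq> \<sigma>" if "\<sigma> \<in> K" "card \<sigma> = Suc d" for \<sigma>
    using that unfolding star_def by blast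
  moreover have "star K \<kappa> \<subseteq> K" by (auto simp: star_def)
  ultimately show ?thesis
    unfolding facets_iff[OF K(1)] facets_iff[OF abstract_complex_star[OF K(1)]] set_eq_iff mem_Collect_eq
    by blast
qed

lemma neighbors_star:
  assumes K: "abstract_complex K" "pure_complex d K"
  shows "neighbors d (star K \<kappa>) \<sigma> \<tau> \<longleftrightarrow> neighbors d K \<sigma> \<tau> \<and> \<kappa> \<subseteq> \<sigma> \<and> \<kappa> \<subseteq> \<tau>"
  by (auto simp: neighbors_iff[OF K(1)] neighbors_iff[OF abstract_complex_star[OF K(1)]] facets_star[OF K])

lemma facet_path_star:
  assumes K: "abstract_complex K" "pure_complex d K"
  shows "facet_path d (star K \<kappa>) \<gamma> \<longleftrightarrow> facet_path d K \<gamma> \<and> (\<forall>\<sigma>\<in>set \<gamma>. \<kappa> \<subseteq> \<sigma>)"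
  by (induction \<gamma> rule: induced_path.induct) (auto simp: facets_star[OF K] neighbors_star[OF K])

section \<open>Transport along facet paths\<close>

fun transport :: "('a set \<Rightarrow> 'a set \<Rightarrow> 'b \<Rightarrow> 'b) \<Rightarrow> 'a set list \<Rightarrow> 'b \<Rightarrow> 'b" where
  "transport T (\<sigma> # \<tau> # \<gamma>) x = transport T (\<tau> # \<gamma>) (T \<sigma> \<tau> x)"
| "transport T \<gamma> x = x"

text \<open>A local system on the facets: a fibre over each facet, and mutually inverse bijections between
the fibres over neighbors.\<close>

locale facet_transport =
  fixes d :: nat and K :: "'a set set"
    and F :: "'a set \<Rightarrow> 'b set" and T :: "'a set \<Rightarrow> 'a set \<Rightarrow> 'b \<Rightarrow> 'b"
  assumes K: "abstract_complex K" "pure_complex d K"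
    and T_mem: "neighbors d K \<sigma> \<tau> \<Longrightarrow> x \<in> F \<sigma> \<Longrightarrow> T \<sigma> \<tau> x \<in> F \<tau>"
    and T_inverse: "neighbors d K \<sigma> \<tau> \<Longrightarrow> x \<in> F \<sigma> \<Longrightarrow> T \<tau> \<sigma> (T \<sigma> \<tau> x) = x"
begin

lemma transport_append:
  assumes "facet_path d K \<alpha>" "facet_path d K \<beta>" "last \<alpha> = hd \<beta>"
  shows "transport T (\<alpha> @ tl \<beta>) x = transport T \<beta> (transport T \<alpha> x)"
  using assms
proof (induction \<alpha> arbitrary: x rule: induced_path.induct)
  case (2 \<sigma>) then show ?case by (cases \<beta>) auto
qed auto

lemma transport_mem:
  assumes "facet_path d K \<gamma>" "x \<in> F (hd \<gamma>)"
  shows "transport T \<gamma> x \<in> F (last \<gamma>)"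
  using assms by (induction \<gamma> arbitrary: x rule: induced_path.induct) (auto simp: T_mem)

lemma transport_rev:
  assumes "facet_path d K \<gamma>" "x \<in> F (hd \<gamma>)"
  shows "transport T (rev \<gamma>) (transport T \<gamma> x) = x"
  using assms
proof (induction \<gamma> arbitrary: x rule: induced_path.induct)
  case (3 \<sigma> \<tau> \<gamma>)
  then have n: "neighbors d K \<sigma> \<tau>" and p: "facet_path d K (\<tau> # \<gamma>)" by auto
  let ?y = "transport T (\<tau> # \<gamma>) (T \<sigma> \<tau> x)"
  have "transport T (rev (\<tau> # \<gamma>) @ tl [\<tau>, \<sigma>]) ?y = transport T [\<tau>, \<sigma>] (transport T (rev (\<tau> # \<gamma>)) ?y)"
    by (rule transport_append)
      (use n p facet_path_rev[OF p] neighbors_sym[OF n] in \<open>auto simp: neighbors_def\<close>)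
  moreover have "transport T (rev (\<tau> # \<gamma>)) ?y = T \<sigma> \<tau> x"
    by (rule 3) (use n p 3 in \<open>auto simp: T_mem\<close>)
  ultimately show ?case using T_inverse[OF n] 3 by simp
qed auto

text \<open>Triviality of the holonomy around \<open>\<kappa>\<close>.\<close>

definition flat_at :: "'a set \<Rightarrow> bool" where
  "flat_at \<kappa> \<longleftrightarrow> (\<forall>\<gamma>. \<forall>x\<in>F (hd \<gamma>). facet_loop d (star K \<kappa>) (hd \<gamma>) \<gamma> \<longrightarrow> transport T \<gamma> x = x)"

text \<open>The elements \<open>a\<close> and \<open>b\<close> of the total space correspond to each other under transport inside the star
of \<open>v\<close>.  If the system is flat at \<open>v\<close>, the classes of this equivalence relation are the sheets over
the star.\<close>

definition joined :: "'a \<Rightarrow> 'a set \<times> 'b \<Rightarrow> 'a set \<times> 'b \<Rightarrow> bool" where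
  "joined v a b \<longleftrightarrow> (\<exists>\<gamma>. facet_path d K \<gamma> \<and> (\<forall>\<sigma>\<in>set \<gamma>. v \<in> \<sigma>) \<and> hd \<gamma> = fst a \<and> last \<gamma> = fst b \<and>
      snd a \<in> F (fst a) \<and> snd b = transport T \<gamma> (snd a))"

lemma joined_mem:
  assumes "joined v a b"
  shows "fst a \<in> facets d K" "fst b \<in> facets d K" "v \<in> fst a" "v \<in> fst b"
    "snd a \<in> F (fst a)" "snd b \<in> F (fst b)"
  using assms unfolding joined_def
  by (metis hd_facet, metis last_facet, metis hd_in_set facet_path_nonempty,
      metis last_in_set facet_path_nonempty, metis, metis transport_mem)

lemma joined_refl: "\<sigma> \<in> facets d K \<Longrightarrow> v \<in> \<sigma> \<Longrightarrow> x \<in> F \<sigma> \<Longrightarrow> joined v (\<sigma>, x) (\<sigma>, x)"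
  unfolding joined_def by (rule exI[of _ "[\<sigma>]"]) simp

lemma joined_step:
  "neighbors d K \<sigma> \<tau> \<Longrightarrow> v \<in> \<sigma> \<inter> \<tau> \<Longrightarrow> x \<in> F \<sigma> \<Longrightarrow> joined v (\<sigma>, x) (\<tau>, T \<sigma> \<tau> x)"
  unfolding joined_def by (rule exI[of _ "[\<sigma>, \<tau>]"]) (auto simp: neighbors_def)

lemma joined_sym:
  assumes "joined v a b" shows "joined v b a"
proof -
  obtain \<gamma> where \<gamma>: "facet_path d K \<gamma>" "\<forall>\<sigma>\<in>set \<gamma>. v \<in> \<sigma>" "hd \<gamma> = fst a" "last \<gamma> = fst b"
    "snd a \<in> F (fst a)" "snd b = transport T \<gamma> (snd a)"
    using assms by (auto simp: joined_def)
  then show ?thesis unfolding joined_def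
    using joined_mem(6)[OF assms] facet_path_nonempty[OF \<gamma>(1)]
    by (intro exI[of _ "rev \<gamma>"]) (auto simp: facet_path_rev transport_rev hd_rev last_rev)
qed

lemma joined_trans:
  assumes "joined v a b" "joined v b c" shows "joined v a c"
proof -
  obtain \<gamma> where \<gamma>: "facet_path d K \<gamma>" "\<forall>\<sigma>\<in>set \<gamma>. v \<in> \<sigma>" "hd \<gamma> = fst a" "last \<gamma> = fst b"
    "snd a \<in> F (fst a)" "snd b = transport T \<gamma> (snd a)"
    using assms(1) by (auto simp: joined_def)
  obtain \<beta> where \<beta>: "facet_path d K \<beta>" "\<forall>\<sigma>\<in>set \<beta>. v \<in> \<sigma>" "hd \<beta> = fst b" "last \<beta> = fst c"
    "snd c = transport T \<beta> (snd b)"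
    using assms(2) by (auto simp: joined_def)
  have ne: "\<gamma> \<noteq> []" "\<beta> \<noteq> []" using facet_path_nonempty \<gamma>(1) \<beta>(1) by auto
  show ?thesis unfolding joined_def
  proof (intro exI[of _ "\<gamma> @ tl \<beta>"] conjI)
    show "\<forall>\<sigma>\<in>set (\<gamma> @ tl \<beta>). v \<in> \<sigma>" using \<gamma>(2) \<beta>(2) by (auto dest: list.set_sel(2)[OF ne(2)])
  qed (use \<gamma> \<beta> ne in \<open>auto simp: facet_path_append transport_append hd_last_append_tl\<close>)
qed

end

locale vertex_flat_transport = facet_transport +
  assumes stars_connected: "locally_strongly_connected d K"
    and vertex_flat: "v \<in> \<Union>K \<Longrightarrow> flat_at {v}"
begin

text \<open>Two candidates for \<open>y\<close> differ by the holonomy of a loop in the star of \<open>v\<close>.\<close>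

lemma joined_unique:
  assumes "joined v a (\<tau>, y)" "joined v a (\<tau>, z)" shows "y = z"
proof -
  have "joined v (\<tau>, y) (\<tau>, z)" using assms joined_sym joined_trans by blast
  then obtain \<gamma> where \<gamma>: "facet_path d K \<gamma>" "\<forall>\<sigma>\<in>set \<gamma>. v \<in> \<sigma>" "hd \<gamma> = \<tau>" "last \<gamma> = \<tau>"
    "y \<in> F \<tau>" "z = transport T \<gamma> y"
    by (auto simp: joined_def)
  moreover have "v \<in> \<Union>K"
    using joined_mem[OF assms(1)] facets_iff[OF K(1)] by auto
  ultimately show ?thesis
    using vertex_flat by (auto simp: flat_at_def facet_loop_def facet_path_star[OF K])
qed

text \<open>Two facets through \<open>v\<close> and \<open>w\<close> are joined inside the star of the face \<open>{v, w}\<close>, which lies in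
  the stars of both vertices.\<close>

lemma common_joined:
  assumes \<sigma>: "\<sigma> \<in> facets d K" and \<tau>: "\<tau> \<in> facets d K" and vw: "{v, w} \<subseteq> \<sigma> \<inter> \<tau>" and x: "x \<in> F \<sigma>"
  obtains y where "joined v (\<sigma>, x) (\<tau>, y)" "joined w (\<sigma>, x) (\<tau>, y)"
proof -
  have "{v, w} \<in> K" using subface[OF K(1)] \<sigma> vw facets_iff[OF K(1)] by blast
  then have "strongly_connected d (star K {v, w})"
    using stars_connected by (simp add: locally_strongly_connected_def)
  then obtain \<gamma> where "facet_path d (star K {v, w}) \<gamma>" "hd \<gamma> = \<sigma>" "last \<gamma> = \<tau>"
    using \<sigma> \<tau> vw by (auto simp: strongly_connected_def facets_star[OF K])
  then have "joined v (\<sigma>, x) (\<tau>, transport T \<gamma> x)" "joined w (\<sigma>, x) (\<tau>, transport T \<gamma> x)"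
    using x by (auto simp: joined_def facet_path_star[OF K])
  then show thesis by (rule that)
qed

text \<open>Sheets over the stars of \<open>v\<close> and \<open>w\<close> agree over the facets containing both: transport along a path
through such facets is the unique candidate for either.\<close>

lemma joined_change_vertex:
  assumes j: "joined v a b" and w: "w \<in> fst a \<inter> fst b" shows "joined w a b"
proof -
  obtain \<sigma> x \<tau> y where ab: "a = (\<sigma>, x)" "b = (\<tau>, y)" by (metis surj_pair)
  obtain z where z: "joined v (\<sigma>, x) (\<tau>, z)" "joined w (\<sigma>, x) (\<tau>, z)"
    using common_joined[of \<sigma> \<tau> v w x] joined_mem[OF j] w ab by auto
  then show ?thesis using joined_unique j ab by metis
qed

end

section \<open>Transport is invariant under homotopy\<close>

text \<open>The support of a point is the vertex set of the smallest simplex containing it, and \<open>y v \<noteq> 0\<close> says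
that \<open>y\<close> lies in the open star of \<open>v\<close>.\<close>

lemma realization_support_nonempty:
  assumes "y \<in> realization K" obtains v where "y v \<noteq> 0"
proof -
  obtain \<sigma> where "(\<Sum>v\<in>\<sigma>. y v) = 1"
    using assms by (auto simp: realization_def closed_simplex_def)
  then show thesis using that by (metis sum.neutral zero_neq_one)
qed

lemma realization_support_facet:
  assumes "pure_complex d K" "y \<in> realization K"
  obtains \<sigma> where "\<sigma> \<in> facets d K" "{v. y v \<noteq> 0} \<subseteq> \<sigma>"
proof -
  obtain \<rho> where \<rho>: "\<rho> \<in> K" "{v. y v \<noteq> 0} \<subseteq> \<rho>"
    using assms(2) by (auto simp: realization_def closed_simplex_def)
  moreover obtain \<sigma> where "\<sigma> \<in> facets d K" "\<rho> \<subseteq> \<sigma>"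
    using assms(1) \<rho>(1) by (auto simp: pure_complex_def)
  ultimately show thesis by (intro that[of \<sigma>]) auto
qed

text \<open>The open stars of the vertices cover the realization; pull them back to the square and take a mesh
below the Lebesgue number.\<close>

lemma fine_grid:
  fixes h :: "real \<times> real \<Rightarrow> 'a \<Rightarrow> real"
  assumes h: "continuous_on ({0..1} \<times> {0..1}) h" "h \<in> {0..1} \<times> {0..1} \<rightarrow> realization K"
  obtains N :: nat where "N > 0"
    "\<And>i j. i < N \<Longrightarrow> j < N \<Longrightarrow> \<exists>v. \<forall>s\<in>{real j / N..real (Suc j) / N}.
       \<forall>t\<in>{real i / N..real (Suc i) / N}. h (s, t) v \<noteq> 0"
proof -
  let ?Q = "{0..1::real} \<times> {0..1::real}"
  define \<C> where "\<C> = {U. open U \<and> (\<exists>v. \<forall>z\<in>U \<inter> ?Q. h z v \<noteq> 0)}"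
  have cover: "\<exists>U\<in>\<C>. z \<in> U" if z: "z \<in> ?Q" for z
  proof -
    obtain v where v: "h z v \<noteq> 0"
      using realization_support_nonempty[of "h z" K] h(2) z by auto
    have "continuous_on ?Q (\<lambda>z. h z v)"
      by (rule continuous_on_product_then_coordinatewise[OF h(1)])
    then obtain U where U: "open U" "U \<inter> ?Q = (\<lambda>z. h z v) -` (- {0}) \<inter> ?Q"
      unfolding continuous_on_open_invariant by (metis open_Compl closed_singleton)
    then have "U \<in> \<C>" "z \<in> U" using z v unfolding \<C>_def by blast+
    then show ?thesis by blast
  qed
  have Q: "compact ?Q" by (intro compact_Times compact_Icc)
  have \<C>_ne: "\<C> \<noteq> {}" using cover[of "(0, 0)"] by auto
  have \<C>_cover: "?Q \<subseteq> \<Union>\<C>" using cover by (meson UnionI subsetI)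
  obtain \<delta> where \<delta>: "\<delta> > 0" "\<And>T. T \<subseteq> ?Q \<Longrightarrow> diameter T < \<delta> \<Longrightarrow> \<exists>U\<in>\<C>. T \<subseteq> U"
  proof (rule Lebesgue_number_lemma[OF Q \<C>_ne \<C>_cover])
    show "open U" if "U \<in> \<C>" for U using that by (simp add: \<C>_def)
  qed (rule that)
  obtain N :: nat where "2 / \<delta> < N" using reals_Archimedean2 by blast
  moreover from this have "real N > 0" using \<delta>(1) by (smt (verit) divide_pos_pos)
  ultimately have N: "N > 0" "2 / N < \<delta>" using \<delta>(1) by (auto simp: field_simps)
  show thesis
  proof (rule that[OF N(1)])
    fix i j assume ij: "i < N" "j < N"
    let ?S = "{real j / N..real (Suc j) / N}" and ?T = "{real i / N..real (Suc i) / N}"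
    have "0 \<le> real k / N" "real (Suc k) / N \<le> 1" if "k < N" for k
      using that by (auto simp: field_simps)
    from this[OF ij(1)] this[OF ij(2)] have "?S \<times> ?T \<subseteq> ?Q"
      by (intro Sigma_mono atLeastatMost_subset_iff[THEN iffD2] disjI2 conjI)
    moreover have "diameter (?S \<times> ?T) \<le> 2 / N"
    proof (rule diameter_le)
      fix p q assume pq: "p \<in> ?S \<times> ?T" "q \<in> ?S \<times> ?T"
      have "norm (p - q) \<le> norm (fst (p - q)) + norm (snd (p - q))"
        by (metis norm_Pair_le prod.collapse)
      also have "\<dots> \<le> 1 / N + 1 / N"
        using pq N(1) by (intro add_mono) (auto simp: abs_le_iff add_divide_distrib)
      finally show "norm (p - q) \<le> 2 / N" by simp
    qed auto
    ultimately obtain U where "U \<in> \<C>" "?S \<times> ?T \<subseteq> U" "?S \<times> ?T \<subseteq> ?Q"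
      using \<delta>(2)[of "?S \<times> ?T"] N(2) by force
    then show "\<exists>v. \<forall>s\<in>?S. \<forall>t\<in>?T. h (s, t) v \<noteq> 0"
      unfolding \<C>_def by blast
  qed
qed

lemma pathstart_induced_path: "\<gamma> \<noteq> [] \<Longrightarrow> induced_path \<gamma> 0 = barycenter (hd \<gamma>)"
  by (induction \<gamma> rule: induced_path.induct) (auto simp: joinpaths_def segment_path_def)

context facet_transport
begin

text \<open>The lift of a path to the total space.  The facet component of \<open>c t\<close> is any facet that contains the
support of \<open>p t\<close>, and it may jump; continuity therefore means that nearby values are joined through
every vertex whose open star contains \<open>p t\<close>.\<close>

definition lift :: "(real \<Rightarrow> 'a \<Rightarrow> real) \<Rightarrow> (real \<Rightarrow> 'a set \<times> 'b) \<Rightarrow> bool" where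
  "lift p c \<longleftrightarrow> (\<forall>t\<in>{0..1}. \<exists>e>0. \<forall>u\<in>{0..1}. \<bar>u - t\<bar> < e \<longrightarrow>
     (\<forall>v. p t v \<noteq> 0 \<longrightarrow> joined v (c t) (c u)))"

lemma lift_refl: "lift p c \<Longrightarrow> t \<in> {0..1} \<Longrightarrow> p t v \<noteq> 0 \<Longrightarrow> joined v (c t) (c t)"
  unfolding lift_def by (metis abs_zero diff_self)

lemma lift_const:
  assumes "\<sigma> \<in> facets d K" "x \<in> F \<sigma>" "\<And>t v. t \<in> {0..1} \<Longrightarrow> p t v \<noteq> 0 \<Longrightarrow> v \<in> \<sigma>"
  shows "lift p (\<lambda>_. (\<sigma>, x))"
  unfolding lift_def using assms joined_refl by (metis zero_less_one)

text \<open>On the way from the ridge to \<open>\<tau>\<close> the facet component jumps from \<open>\<sigma>\<close> to \<open>\<tau>\<close> at time \<open>0\<close>.  There the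
support is the ridge, and all its vertices lie in both facets.\<close>

lemma lift_crossing:
  assumes n: "neighbors d K \<sigma> \<tau>" and x: "x \<in> F \<sigma>"
  shows "lift (segment_path (barycenter (\<sigma> \<inter> \<tau>)) (barycenter \<tau>))
    (\<lambda>t. if t = 0 then (\<sigma>, x) else (\<tau>, T \<sigma> \<tau> x))" (is "lift ?p ?c")
  unfolding lift_def
proof
  have st: "\<sigma> \<in> facets d K" "\<tau> \<in> facets d K" using n by (auto simp: neighbors_def)
  have y: "T \<sigma> \<tau> x \<in> F \<tau>" by (rule T_mem[OF n x])
  fix t :: real assume t: "t \<in> {0..1}"
  show "\<exists>e>0. \<forall>u\<in>{0..1}. \<bar>u - t\<bar> < e \<longrightarrow> (\<forall>v. ?p t v \<noteq> 0 \<longrightarrow> joined v (?c t) (?c u))"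
  proof (cases "t = 0")
    case True
    have "joined v (?c t) (?c u)" if "?p t v \<noteq> 0" for u v
    proof -
      have "v \<in> \<sigma> \<inter> \<tau>" using that True by (auto simp: segment_path_def barycenter_def split: if_splits)
      then show ?thesis
        using joined_refl[OF st(1) _ x] joined_step[OF n _ x] True by auto
    qed
    then show ?thesis by (intro exI[of _ 1]) auto
  next
    case False
    have "joined v (?c t) (?c u)" if "?p t v \<noteq> 0" "u \<noteq> 0" for u v
    proof -
      have "v \<in> \<tau>" using that by (auto simp: segment_path_def barycenter_def split: if_splits)
      then show ?thesis using joined_refl[OF st(2) _ y] False that by auto
    qed
    then show ?thesis using t False by (intro exI[of _ t]) auto
  qed
qed

lemma lift_join:
  assumes p: "lift p c" and q: "lift q c'" and c: "c 1 = c' 0" and pq: "p 1 = q 0"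
  shows "lift (p +++ q) (\<lambda>t. if t \<le> 1/2 then c (2 * t) else c' (2 * t - 1))" (is "lift ?p ?c")
  unfolding lift_def
proof
  fix t :: real assume t: "t \<in> {0..1}"
  consider "t < 1/2" | "t = 1/2" | "t > 1/2" by linarith
  then show "\<exists>e>0. \<forall>u\<in>{0..1}. \<bar>u - t\<bar> < e \<longrightarrow> (\<forall>v. ?p t v \<noteq> 0 \<longrightarrow> joined v (?c t) (?c u))"
  proof cases
    case 1
    then obtain e where e: "e > 0"
      "\<And>u v. u \<in> {0..1} \<Longrightarrow> \<bar>u - 2 * t\<bar> < e \<Longrightarrow> p (2 * t) v \<noteq> 0 \<Longrightarrow> joined v (c (2 * t)) (c u)"
      using p t unfolding lift_def by (metis (no_types, lifting) atLeastAtMost_iff bspec less_eq_real_def mult_2 add_nonneg_nonneg field_sum_of_halves add_strict_mono)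
    have "joined v (?c t) (?c u)"
      if "u \<in> {0..1}" "\<bar>u - t\<bar> < min (e/2) (1/2 - t)" "?p t v \<noteq> 0" for u v
      using that 1 e(2)[of "2 * u" v] by (auto simp: joinpaths_def abs_if split: if_splits)
    then show ?thesis using e(1) 1 by (intro exI[of _ "min (e/2) (1/2 - t)"]) auto
  next
    case 2
    obtain e where e: "e > 0"
      "\<And>u v. u \<in> {0..1} \<Longrightarrow> \<bar>u - 1\<bar> < e \<Longrightarrow> p 1 v \<noteq> 0 \<Longrightarrow> joined v (c 1) (c u)"
      using p unfolding lift_def by (metis atLeastAtMost_iff order_refl zero_le_one)
    obtain e' where e': "e' > 0"
      "\<And>u v. u \<in> {0..1} \<Longrightarrow> \<bar>u - 0\<bar> < e' \<Longrightarrow> q 0 v \<noteq> 0 \<Longrightarrow> joined v (c' 0) (c' u)"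
      using q unfolding lift_def by (metis atLeastAtMost_iff order_refl zero_le_one)
    have "joined v (?c t) (?c u)"
      if "u \<in> {0..1}" "\<bar>u - t\<bar> < min (e/2) (e'/2)" "?p t v \<noteq> 0" for u v
    proof (cases "u \<le> 1/2")
      case True
      then show ?thesis using that e(2)[of "2 * u" v] unfolding 2 by (auto simp: joinpaths_def)
    next
      case False
      then show ?thesis using that e'(2)[of "2 * u - 1" v] c pq unfolding 2 by (auto simp: joinpaths_def)
    qed
    then show ?thesis using e(1) e'(1) by (intro exI[of _ "min (e/2) (e'/2)"]) auto
  next
    case 3
    have "2 * t - 1 \<in> {0..1}" using 3 t by auto
    then obtain e where e: "e > 0"
      "\<And>u v. u \<in> {0..1} \<Longrightarrow> \<bar>u - (2 * t - 1)\<bar> < e \<Longrightarrow> q (2 * t - 1) v \<noteq> 0 \<Longrightarrow> joined v (c' (2 * t - 1)) (c' u)"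
      using q unfolding lift_def by blast
    have "joined v (?c t) (?c u)"
      if "u \<in> {0..1}" "\<bar>u - t\<bar> < min (e/2) (t - 1/2)" "?p t v \<noteq> 0" for u v
      using that 3 e(2)[of "2 * u - 1" v] by (auto simp: joinpaths_def abs_if split: if_splits)
    then show ?thesis using e(1) 3 by (intro exI[of _ "min (e/2) (t - 1/2)"]) auto
  qed
qed

text \<open>As long as the path stays in the open star of \<open>v\<close>, its lift stays on one sheet over that star, because
the sheet is a locally constant function on an interval.\<close>

lemma lift_joined:
  assumes p: "lift p c" and ab: "0 \<le> a" "a \<le> b" "b \<le> 1" and v: "\<And>t. t \<in> {a..b} \<Longrightarrow> p t v \<noteq> 0"
  shows "joined v (c a) (c b)"
proof -
  let ?f = "\<lambda>t. {z. joined v (c t) z}"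
  have "?f constant_on {a..b}"
  proof (rule locally_constant_imp_constant)
    fix t assume t: "t \<in> {a..b}"
    then obtain e where e: "e > 0" "\<And>u. u \<in> {0..1} \<Longrightarrow> \<bar>u - t\<bar> < e \<Longrightarrow> joined v (c t) (c u)"
      using p v[OF t] ab unfolding lift_def by (metis atLeastAtMost_iff order_trans)
    have "?f u = ?f t" if "u \<in> {a..b} \<inter> ball t e" for u
    proof -
      have "joined v (c t) (c u)"
        using that ab by (intro e(2)) (auto simp: dist_real_def)
      then show ?thesis using joined_sym joined_trans by blast
    qed
    moreover have "openin (top_of_set {a..b}) ({a..b} \<inter> ball t e)"
      by (rule openin_open_Int) simp
    moreover have "t \<in> {a..b} \<inter> ball t e" using t e(1) by simp
    ultimately show "\<exists>S. openin (top_of_set {a..b}) S \<and> t \<in> S \<and> (\<forall>u\<in>S. ?f u = ?f t)"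
      by (intro exI conjI ballI)
  qed simp
  then obtain Z where "\<And>t. t \<in> {a..b} \<Longrightarrow> ?f t = Z" unfolding constant_on_def by blast
  then have "?f a = Z" "?f b = Z" using ab by auto
  moreover have "joined v (c b) (c b)" using lift_refl[OF p] v[of b] ab by auto
  ultimately show ?thesis by blast
qed

lemma lift_induced_path:
  assumes "facet_path d K \<gamma>" "x \<in> F (hd \<gamma>)"
  shows "\<exists>c. lift (induced_path \<gamma>) c \<and> c 0 = (hd \<gamma>, x) \<and> c 1 = (last \<gamma>, transport T \<gamma> x)"
  using assms
proof (induction \<gamma> arbitrary: x rule: induced_path.induct)
  case (2 \<sigma>)
  then have "lift (induced_path [\<sigma>]) (\<lambda>_. (\<sigma>, x))"
    by (intro lift_const) (auto simp: barycenter_def split: if_splits)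
  then show ?case by (intro exI[of _ "\<lambda>_. (\<sigma>, x)"]) auto
next
  case (3 \<sigma> \<tau> \<gamma>)
  then have n: "neighbors d K \<sigma> \<tau>" and x: "x \<in> F \<sigma>" by auto
  obtain c where c: "lift (induced_path (\<tau> # \<gamma>)) c" "c 0 = (\<tau>, T \<sigma> \<tau> x)"
    "c 1 = (last (\<tau> # \<gamma>), transport T (\<tau> # \<gamma>) (T \<sigma> \<tau> x))"
    using 3 T_mem[OF n x] by auto
  have l1: "lift (segment_path (barycenter \<sigma>) (barycenter (\<sigma> \<inter> \<tau>))) (\<lambda>_. (\<sigma>, x))"
    using n x by (intro lift_const)
      (auto simp: neighbors_def segment_path_def barycenter_def split: if_splits)
  note l2 = lift_join[OF lift_crossing[OF n x] c(1)]
  have l: "lift (induced_path (\<sigma> # \<tau> # \<gamma>)) (\<lambda>t. if t \<le> 1/2 then (\<sigma>, x) else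
      (if 2 * t - 1 \<le> 1/2 then if 2 * (2 * t - 1) = 0 then (\<sigma>, x) else (\<tau>, T \<sigma> \<tau> x)
       else c (2 * (2 * t - 1) - 1)))"
    unfolding induced_path.simps
    by (rule lift_join[OF l1 l2])
      (use c pathstart_induced_path[of "\<tau> # \<gamma>"] in \<open>auto simp: segment_path_def joinpaths_def\<close>)
  show ?case by (intro exI conjI, rule l) (use c in auto)
qed auto

end

context vertex_flat_transport
begin

text \<open>The rows of the grid are handled one after the other.  Each grid point gets a facet containing its
support, and a row carries fibre elements \<open>z i\<close> at its grid points such that consecutive ones are
joined.  The given lift provides the bottom row.  Moving the elements of a row upwards through the
cells gives a row with the same ends, because the homotopy is constant on the vertical sides.  In the
top row all facets are \<open>\<sigma>\<close>, so all its elements are equal.\<close>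

lemma lift_ends_agree:
  fixes h :: "real \<times> real \<Rightarrow> 'a \<Rightarrow> real"
  assumes h: "continuous_on ({0..1} \<times> {0..1}) h" "h \<in> {0..1} \<times> {0..1} \<rightarrow> realization K"
    and c: "lift (\<lambda>t. h (0, t)) c" "c 0 = (\<sigma>, x)" "c 1 = (\<sigma>, y)"
    and sides: "\<And>s. s \<in> {0..1} \<Longrightarrow> h (s, 0) = b" "\<And>s. s \<in> {0..1} \<Longrightarrow> h (s, 1) = b"
    and top: "\<And>t. t \<in> {0..1} \<Longrightarrow> h (1, t) = b"
    and b: "{v. b v \<noteq> 0} \<subseteq> \<sigma>" and \<sigma>: "\<sigma> \<in> facets d K"
  shows "x = y"
proof -
  obtain N :: nat where N: "N > 0"
    and cells: "\<And>i j. i < N \<Longrightarrow> j < N \<Longrightarrow> \<exists>v. \<forall>s\<in>{real j / N..real (Suc j) / N}.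
       \<forall>t\<in>{real i / N..real (Suc i) / N}. h (s, t) v \<noteq> 0"
    using fine_grid[OF h] by metis
  define g where "g i = real i / N" for i
  have g: "g 0 = 0" "g N = 1" and g01: "i \<le> N \<Longrightarrow> g i \<in> {0..1}" and gS: "g i \<le> g (Suc i)" for i
    using N by (auto simp: g_def divide_right_mono)
  obtain V where V: "\<And>i j s t. i < N \<Longrightarrow> j < N \<Longrightarrow> s \<in> {g j..g (Suc j)} \<Longrightarrow> t \<in> {g i..g (Suc i)} \<Longrightarrow>
      h (s, t) (V i j) \<noteq> 0"
    using cells unfolding g_def by metis
  define \<phi> where "\<phi> j i = (if j = 0 then fst (c (g i)) else if i = 0 \<or> i = N \<or> j = N then \<sigma>
    else SOME \<tau>. \<tau> \<in> facets d K \<and> {v. h (g j, g i) v \<noteq> 0} \<subseteq> \<tau>)" for j i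
  have \<phi>_side: "\<phi> j 0 = \<sigma>" "\<phi> j N = \<sigma>" for j using c g by (auto simp: \<phi>_def)
  have \<phi>_top: "\<phi> N i = \<sigma>" for i using N by (auto simp: \<phi>_def)
  have hK: "h (g j, g i) \<in> realization K" if "i \<le> N" "j \<le> N" for i j
    using h(2) g01 that by auto
  have \<phi>: "\<phi> j i \<in> facets d K \<and> {v. h (g j, g i) v \<noteq> 0} \<subseteq> \<phi> j i" if ij: "i \<le> N" "j \<le> N" for i j
  proof -
    consider "j = 0" | "j > 0" "i = 0 \<or> i = N \<or> j = N" | "j > 0" "\<not> (i = 0 \<or> i = N \<or> j = N)" by blast
    then show ?thesis
    proof cases
      case 1
      have "joined v (c (g i)) (c (g i))" if "h (g j, g i) v \<noteq> 0" for v
        using lift_refl[OF c(1) g01[OF ij(1)]] that 1 g by simp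
      then show ?thesis
        using joined_mem realization_support_nonempty[OF hK[OF ij]] 1 unfolding \<phi>_def by (simp add: subset_iff) metis
    next
      case 2
      then have "h (g j, g i) = b" using sides top g g01 ij by auto
      then show ?thesis using 2 b \<sigma> by (auto simp: \<phi>_def)
    next
      case 3
      then have "\<phi> j i = (SOME \<tau>. \<tau> \<in> facets d K \<and> {v. h (g j, g i) v \<noteq> 0} \<subseteq> \<tau>)"
        by (simp add: \<phi>_def)
      moreover have "\<exists>\<tau>. \<tau> \<in> facets d K \<and> {v. h (g j, g i) v \<noteq> 0} \<subseteq> \<tau>"
        using realization_support_facet[OF K(2) hK[OF ij]] by metis
      ultimately show ?thesis using someI_ex[of "\<lambda>\<tau>. \<tau> \<in> facets d K \<and> {v. h (g j, g i) v \<noteq> 0} \<subseteq> \<tau>"]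
        by simp
    qed
  qed
  have V\<phi>: "V i j \<in> \<phi> j' i'"
    if "i < N" "j < N" "i' = i \<or> i' = Suc i" "j' = j \<or> j' = Suc j" for i j i' j'
  proof -
    have "h (g j', g i') (V i j) \<noteq> 0"
      using that gS by (intro V) auto
    then show ?thesis using \<phi>[of i' j'] that by auto
  qed
  \<comment> \<open>The vertex in the condition is arbitrary, so that the edge may be seen from the cell below it
    as well as from the cell above it.\<close>
  define row where "row j z \<longleftrightarrow> (\<forall>i<N. \<forall>v. (\<forall>t\<in>{g i..g (Suc i)}. h (g j, t) v \<noteq> 0) \<longrightarrow>
      joined v (\<phi> j i, z i) (\<phi> j (Suc i), z (Suc i)))" for j z
  have "\<exists>z. z 0 = x \<and> z N = y \<and> row j z" if "j \<le> N" for j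
    using that
  proof (induction j)
    case 0
    have "joined v (c (g i)) (c (g (Suc i)))"
      if "i < N" "\<forall>t\<in>{g i..g (Suc i)}. h (g 0, t) v \<noteq> 0" for i v
      using that gS g g01[of i] g01[of "Suc i"] by (intro lift_joined[OF c(1)]) auto
    then have "row 0 (\<lambda>i. snd (c (g i)))" by (auto simp: row_def \<phi>_def)
    then show ?case using c g by (intro exI[of _ "\<lambda>i. snd (c (g i))"]) auto
  next
    case (Suc j)
    then obtain z where z: "z 0 = x" "z N = y" "row j z" by auto
    have j: "j < N" using Suc by simp
    have cell: "joined (V i j) (\<phi> j i, z i) (\<phi> j (Suc i), z (Suc i))" if "i < N" for i
    proof -
      have "\<forall>t\<in>{g i..g (Suc i)}. h (g j, t) (V i j) \<noteq> 0" using V[OF that j] gS[of j] by auto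
      then show ?thesis using z(3) that unfolding row_def by blast
    qed
    \<comment> \<open>Grid point \<open>i\<close> is moved through cell \<open>i\<close>; only the last point needs the cell to its left.\<close>
    define w where "w i = V (min i (N - 1)) j" for i
    have "\<exists>y. joined (w i) (\<phi> j i, z i) (\<phi> (Suc j) i, y)" if i: "i \<le> N" for i
    proof -
      define k where "k = min i (N - 1)"
      have k: "k < N" "i = k \<or> i = Suc k" "w i = V k j" using N i by (auto simp: k_def w_def)
      have "z i \<in> F (\<phi> j i)" using joined_mem(5,6)[OF cell[OF k(1)]] k(2) by auto
      moreover have "\<phi> j i \<in> facets d K" "\<phi> (Suc j) i \<in> facets d K" using \<phi> i j by auto
      moreover have "{V k j, V k j} \<subseteq> \<phi> j i \<inter> \<phi> (Suc j) i" using V\<phi>[OF k(1) j] k(2) by auto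
      ultimately show ?thesis unfolding k(3) by (metis common_joined)
    qed
    then obtain z' where z': "\<And>i. i \<le> N \<Longrightarrow> joined (w i) (\<phi> j i, z i) (\<phi> (Suc j) i, z' i)" by metis
    have ends: "z' i = z i" if "i \<in> {0, N}" for i
    proof -
      have "joined (w i) (\<sigma>, z i) (\<sigma>, z' i)" using z'[of i] that \<phi>_side by auto
      moreover from joined_mem[OF this] have "joined (w i) (\<sigma>, z i) (\<sigma>, z i)" by (auto intro: joined_refl)
      ultimately show ?thesis using joined_unique by blast
    qed
    have "row (Suc j) z'" unfolding row_def
    proof (intro allI impI)
      fix i v assume i: "i < N" and v: "\<forall>t\<in>{g i..g (Suc i)}. h (g (Suc j), t) v \<noteq> 0"
      have up: "joined (V i j) (\<phi> j i', z i') (\<phi> (Suc j) i', z' i')" if "i' = i \<or> i' = Suc i" for i'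
        using that i j V\<phi>[OF i j] by (intro joined_change_vertex[OF z']) auto
      \<comment> \<open>Go around the other three sides of the cell.\<close>
      have "joined (V i j) (\<phi> (Suc j) i, z' i) (\<phi> (Suc j) (Suc i), z' (Suc i))"
        using joined_trans[OF joined_sym[OF up[of i]] joined_trans[OF cell[OF i] up[of "Suc i"]]] by simp
      moreover have "v \<in> \<phi> (Suc j) i \<inter> \<phi> (Suc j) (Suc i)"
        using \<phi>[of i "Suc j"] \<phi>[of "Suc i" "Suc j"] i j v gS[of i] by auto
      ultimately show "joined v (\<phi> (Suc j) i, z' i) (\<phi> (Suc j) (Suc i), z' (Suc i))"
        by - (rule joined_change_vertex, assumption, simp)
    qed
    then show ?case using ends z by (intro exI[of _ z']) auto
  qed
  then obtain z where z: "z 0 = x" "z N = y" "row N z" by (meson order_refl)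
  have "z (Suc i) = z i" if i: "i < N" for i
  proof -
    have "g N \<in> {g (N - 1)..g (Suc (N - 1))}" using gS[of "N - 1"] N by simp
    then have "\<forall>t\<in>{g i..g (Suc i)}. h (g N, t) (V i (N - 1)) \<noteq> 0"
      using V[of i "N - 1" "g N"] i N by simp
    then have "joined (V i (N - 1)) (\<sigma>, z i) (\<sigma>, z (Suc i))"
      using z(3) i unfolding row_def \<phi>_top by blast
    moreover from joined_mem[OF this] have "joined (V i (N - 1)) (\<sigma>, z i) (\<sigma>, z i)"
      by (auto intro: joined_refl)
    ultimately show ?thesis using joined_unique by blast
  qed
  then have "z i = z 0" if "i \<le> N" for i using that by (induction i) auto
  then show ?thesis using z by auto
qed

text \<open>The lift of the induced path ends at the transported element, so a null-homotopy forces it to be the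
element at the start.\<close>

theorem transport_null_homotopic:
  assumes \<gamma>: "null_homotopic_facet_loop d K \<sigma> \<gamma>" and x: "x \<in> F \<sigma>"
  shows "transport T \<gamma> x = x"
proof -
  have path: "facet_path d K \<gamma>" "hd \<gamma> = \<sigma>" "last \<gamma> = \<sigma>"
    and hom: "homotopic_paths (realization K) (induced_path \<gamma>) (\<lambda>_. barycenter \<sigma>)"
    using \<gamma> by (auto simp: null_homotopic_facet_loop_def facet_loop_def)
  obtain h :: "real \<times> real \<Rightarrow> 'a \<Rightarrow> real"
    where h: "continuous_on ({0..1} \<times> {0..1}) h" "h \<in> {0..1} \<times> {0..1} \<rightarrow> realization K"
    and h0: "\<forall>t\<in>{0..1}. h (0, t) = induced_path \<gamma> t"
    and h1: "\<forall>t\<in>{0..1}. h (1, t) = barycenter \<sigma>"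
    and ends: "\<forall>s\<in>{0..1}. pathstart (h \<circ> Pair s) = pathstart (induced_path \<gamma>) \<and>
      pathfinish (h \<circ> Pair s) = pathfinish (induced_path \<gamma>)"
    using hom unfolding homotopic_paths by blast
  have "pathstart (induced_path \<gamma>) = barycenter \<sigma>" "pathfinish (induced_path \<gamma>) = barycenter \<sigma>"
    using homotopic_paths_imp_pathstart[OF hom] homotopic_paths_imp_pathfinish[OF hom]
    by (auto simp: pathstart_def pathfinish_def)
  then have sides: "h (s, 0) = barycenter \<sigma>" "h (s, 1) = barycenter \<sigma>" if "s \<in> {0..1}" for s
    using ends that by (auto simp: pathstart_def pathfinish_def)
  obtain c where c: "lift (induced_path \<gamma>) c" "c 0 = (\<sigma>, x)" "c 1 = (\<sigma>, transport T \<gamma> x)"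
    using lift_induced_path[OF path(1)] path x by auto
  have "lift (\<lambda>t. h (0, t)) c" using c(1) h0 unfolding lift_def by auto
  then have "x = transport T \<gamma> x"
    by (rule lift_ends_agree[OF h _ c(2,3) sides bspec[OF h1]])
      (use hd_facet[OF path(1)] path in \<open>auto simp: barycenter_def split: if_splits\<close>)
  then show ?thesis by simp
qed

end

section \<open>Induced paths\<close>

lemma segment_path_simps [simp]:
  "pathstart (segment_path p q) = p" "pathfinish (segment_path p q) = q"
  "reversepath (segment_path p q) = segment_path q p"
  by (auto simp: segment_path_def pathstart_def pathfinish_def reversepath_def fun_eq_iff)

lemma path_segment_path [simp]: "path (segment_path p q)"
  unfolding path_def segment_path_def
  by (intro continuous_on_coordinatewise_then_product continuous_intros)

lemma segment_path_in_closed_simplex: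
  assumes "p \<in> closed_simplex \<sigma>" "q \<in> closed_simplex \<sigma>" "t \<in> {0..1}"
  shows "segment_path p q t \<in> closed_simplex \<sigma>"
  using assms by (auto simp: closed_simplex_def segment_path_def sum.distrib simp flip: sum_distrib_left)

lemma barycenter_in_closed_simplex:
  assumes "finite \<sigma>" "\<rho> \<subseteq> \<sigma>" "\<rho> \<noteq> {}"
  shows "barycenter \<rho> \<in> closed_simplex \<sigma>"
proof -
  have "(\<Sum>v\<in>\<sigma>. barycenter \<rho> v) = (\<Sum>v\<in>\<rho>. 1 / real (card \<rho>))"
    unfolding barycenter_def using assms by (simp add: sum.If_cases Int_absorb1)
  also have "\<dots> = 1" using assms finite_subset[of \<rho> \<sigma>] by simp
  finally show ?thesis using assms(2) by (auto simp: closed_simplex_def barycenter_def)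
qed

lemma path_image_segment_path:
  assumes "\<sigma> \<in> K" "p \<in> closed_simplex \<sigma>" "q \<in> closed_simplex \<sigma>"
  shows "path_image (segment_path p q) \<subseteq> realization K"
  using assms segment_path_in_closed_simplex unfolding path_image_def realization_def by blast

lemma path_image_crossing:
  assumes K: "abstract_complex K" and n: "neighbors d K \<sigma> \<tau>"
  shows "path_image (segment_path (barycenter \<sigma>) (barycenter (\<sigma> \<inter> \<tau>))) \<subseteq> realization K"
    and "path_image (segment_path (barycenter (\<sigma> \<inter> \<tau>)) (barycenter \<tau>)) \<subseteq> realization K"
proof -
  have st: "\<sigma> \<in> K" "\<tau> \<in> K" "\<sigma> \<inter> \<tau> \<noteq> {}"
    using n neighbors_iff[OF K] facets_iff[OF K] by auto
  have "barycenter \<sigma> \<in> closed_simplex \<sigma>" "barycenter (\<sigma> \<inter> \<tau>) \<in> closed_simplex \<sigma>"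
    "barycenter \<tau> \<in> closed_simplex \<tau>" "barycenter (\<sigma> \<inter> \<tau>) \<in> closed_simplex \<tau>"
    using st finite_face[OF K] nonempty_face[OF K] by (auto intro!: barycenter_in_closed_simplex)
  then show "path_image (segment_path (barycenter \<sigma>) (barycenter (\<sigma> \<inter> \<tau>))) \<subseteq> realization K"
    "path_image (segment_path (barycenter (\<sigma> \<inter> \<tau>)) (barycenter \<tau>)) \<subseteq> realization K"
    using st path_image_segment_path by blast+
qed

lemma induced_path_props:
  assumes K: "abstract_complex K" and "facet_path d K \<gamma>"
  shows "path (induced_path \<gamma>) \<and> path_image (induced_path \<gamma>) \<subseteq> realization K \<and>
    pathstart (induced_path \<gamma>) = barycenter (hd \<gamma>) \<and> pathfinish (induced_path \<gamma>) = barycenter (last \<gamma>)"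
  using assms(2)
proof (induction \<gamma> rule: induced_path.induct)
  case (2 \<sigma>)
  then have "\<sigma> \<in> K" using facets_iff[OF K] by auto
  then have "barycenter \<sigma> \<in> realization K"
    using barycenter_in_closed_simplex[of \<sigma> \<sigma>] finite_face[OF K] nonempty_face[OF K]
    by (auto simp: realization_def)
  then show ?case by (auto simp: path_def path_image_def pathstart_def pathfinish_def)
next
  case (3 \<sigma> \<tau> \<gamma>)
  then show ?case using path_image_crossing[OF K, of d \<sigma> \<tau>] by (simp add: subset_path_image_join)
qed auto

text \<open>The loops that simple connectivity contracts are free, hence the detour over
\<open>homotopic_loops_const_imp_homotopic_paths\<close>.\<close>

lemma simply_connected_null_homotopic:
  assumes K: "abstract_complex K" and \<gamma>: "facet_loop d K \<sigma> \<gamma>"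
    and sc: "simply_connected (realization K)"
  shows "null_homotopic_facet_loop d K \<sigma> \<gamma>"
proof -
  have \<gamma>': "facet_path d K \<gamma>" "hd \<gamma> = \<sigma>" "last \<gamma> = \<sigma>" using \<gamma> by (auto simp: facet_loop_def)
  note p = induced_path_props[OF K \<gamma>'(1)]
  have "barycenter \<sigma> \<in> realization K"
    using p \<gamma>' by (metis pathstart_in_path_image subsetD)
  then have "path (\<lambda>_. barycenter \<sigma>) \<and> path_image (\<lambda>_. barycenter \<sigma>) \<subseteq> realization K \<and>
      pathfinish (\<lambda>_. barycenter \<sigma>) = pathstart (\<lambda>_. barycenter \<sigma>)"
    by (auto simp: path_def path_image_def pathstart_def pathfinish_def)
  then have "homotopic_loops (realization K) (induced_path \<gamma>) (\<lambda>_. barycenter \<sigma>)"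
    using sc p \<gamma>' unfolding simply_connected_def by metis
  from homotopic_loops_const_imp_homotopic_paths[OF this] show ?thesis
    using \<gamma> p \<gamma>' by (simp add: null_homotopic_facet_loop_def)
qed

section \<open>Flatness at all faces via links\<close>

lemma abstract_complex_link:
  assumes K: "abstract_complex K" shows "abstract_complex (link K \<kappa>)"
proof (rule abstract_complexI)
  fix \<rho> \<tau> assume \<rho>: "\<rho> \<in> link K \<kappa>" and \<tau>: "\<tau> \<subseteq> \<rho>" "\<tau> \<noteq> {}"
  then have r: "\<rho> \<in> K" "\<rho> \<union> \<kappa> \<in> K" "\<rho> \<inter> \<kappa> = {}" by (auto simp: link_def)
  have "\<tau> \<in> K" by (rule subface[OF K r(1) \<tau>])
  moreover have "\<tau> \<union> \<kappa> \<in> K" by (rule subface[OF K r(2)]) (use \<tau> in auto)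
  ultimately show "\<tau> \<in> link K \<kappa>" using r(3) \<tau> unfolding link_def by auto
qed (auto simp: link_def finite_face[OF K] nonempty_face[OF K])

text \<open>Adding the vertices of \<open>\<kappa>\<close> identifies the facets of the link with the facets of the star.  The
lemmas below do the same for neighbors and facet paths; there the bound on \<open>card \<kappa>\<close> is strict,
since otherwise the link has dimension \<open>0\<close> and its facets have no neighbors.\<close>

lemma facets_link:
  assumes K: "abstract_complex K" and \<kappa>: "\<kappa> \<in> K" "card \<kappa> \<le> d"
  shows "\<rho> \<in> facets (d - card \<kappa>) (link K \<kappa>) \<longleftrightarrow> \<rho> \<inter> \<kappa> = {} \<and> \<rho> \<union> \<kappa> \<in> facets d K"
proof -
  have c: "card (\<rho> \<union> \<kappa>) = card \<rho> + card \<kappa>" if "\<rho> \<inter> \<kappa> = {}" "finite \<rho>"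
    using that finite_face[OF K \<kappa>(1)] by (simp add: card_Un_disjoint)
  show ?thesis
  proof
    assume a: "\<rho> \<in> facets (d - card \<kappa>) (link K \<kappa>)"
    then have "\<rho> \<inter> \<kappa> = {}" "\<rho> \<in> K" "\<rho> \<union> \<kappa> \<in> K" "card \<rho> = Suc (d - card \<kappa>)"
      using facets_iff[OF abstract_complex_link[OF K]] by (auto simp: link_def)
    then show "\<rho> \<inter> \<kappa> = {} \<and> \<rho> \<union> \<kappa> \<in> facets d K"
      using c finite_face[OF K] \<kappa> by (auto simp: facets_iff[OF K])
  next
    assume a: "\<rho> \<inter> \<kappa> = {} \<and> \<rho> \<union> \<kappa> \<in> facets d K"
    then have r: "\<rho> \<union> \<kappa> \<in> K" "card (\<rho> \<union> \<kappa>) = Suc d" by (auto simp: facets_iff[OF K])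
    then have "finite \<rho>" using finite_face[OF K] by blast
    then have "card \<rho> = Suc (d - card \<kappa>)" using c a r \<kappa> by simp
    moreover from this have "\<rho> \<in> K" using subface[OF K r(1), of \<rho>] by force
    moreover from this have "\<rho> \<in> link K \<kappa>" using a r(1) by (simp add: link_def)
    ultimately show "\<rho> \<in> facets (d - card \<kappa>) (link K \<kappa>)"
      by (simp add: facets_iff[OF abstract_complex_link[OF K]])
  qed
qed

lemma pure_complex_link:
  assumes K: "abstract_complex K" "pure_complex d K" and \<kappa>: "\<kappa> \<in> K" "card \<kappa> \<le> d"
  shows "pure_complex (d - card \<kappa>) (link K \<kappa>)"
  unfolding pure_complex_def
proof
  fix \<rho> assume "\<rho> \<in> link K \<kappa>"
  then have \<rho>: "\<rho> \<inter> \<kappa> = {}" "\<rho> \<union> \<kappa> \<in> K" by (auto simp: link_def)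
  then obtain \<sigma> where \<sigma>: "\<sigma> \<in> facets d K" "\<rho> \<union> \<kappa> \<subseteq> \<sigma>" using K(2) by (auto simp: pure_complex_def)
  then have "\<sigma> - \<kappa> \<union> \<kappa> = \<sigma>" "(\<sigma> - \<kappa>) \<inter> \<kappa> = {}" by auto
  then have "\<sigma> - \<kappa> \<in> facets (d - card \<kappa>) (link K \<kappa>)"
    using \<sigma>(1) by (simp add: facets_link[OF K(1) \<kappa>])
  then show "\<exists>\<tau>\<in>facets (d - card \<kappa>) (link K \<kappa>). \<rho> \<subseteq> \<tau>" using \<sigma> \<rho> by blast
qed

lemma neighbors_link:
  assumes K: "abstract_complex K" and \<kappa>: "\<kappa> \<in> K" "card \<kappa> < d"
  shows "neighbors (d - card \<kappa>) (link K \<kappa>) \<rho> \<tau> \<longleftrightarrow>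
    \<rho> \<inter> \<kappa> = {} \<and> \<tau> \<inter> \<kappa> = {} \<and> neighbors d K (\<rho> \<union> \<kappa>) (\<tau> \<union> \<kappa>)"
proof -
  have "card ((\<rho> \<union> \<kappa>) \<inter> (\<tau> \<union> \<kappa>)) = card (\<rho> \<inter> \<tau>) + card \<kappa>"
    if "\<rho> \<inter> \<kappa> = {}" "\<tau> \<inter> \<kappa> = {}" "\<rho> \<union> \<kappa> \<in> facets d K"
  proof -
    have "finite (\<rho> \<union> \<kappa>)" using that facets_iff[OF K] finite_face[OF K] by blast
    moreover have "(\<rho> \<union> \<kappa>) \<inter> (\<tau> \<union> \<kappa>) = (\<rho> \<inter> \<tau>) \<union> \<kappa>" by auto
    ultimately show ?thesis using that by (simp add: card_Un_disjoint disjoint_iff)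
  qed
  then show ?thesis
    using \<kappa> facets_link[OF K \<kappa>(1), of d]
    by (auto simp: neighbors_iff[OF K] neighbors_iff[OF abstract_complex_link[OF K]])
qed

lemma facet_path_link:
  assumes K: "abstract_complex K" and \<kappa>: "\<kappa> \<in> K" "card \<kappa> < d"
  shows "facet_path (d - card \<kappa>) (link K \<kappa>) \<gamma> \<longleftrightarrow>
    (\<forall>\<rho>\<in>set \<gamma>. \<rho> \<inter> \<kappa> = {}) \<and> facet_path d K (map (\<lambda>\<rho>. \<rho> \<union> \<kappa>) \<gamma>)"
  using \<kappa> by (induction \<gamma> rule: induced_path.induct)
    (auto simp: facets_link[OF K] neighbors_link[OF K])

lemma facet_path_link_of_star:
  assumes K: "abstract_complex K" "pure_complex d K" and \<kappa>: "\<kappa> \<in> K" "card \<kappa> < d"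
    and \<gamma>: "facet_path d (star K (\<kappa>' \<union> \<kappa>)) \<gamma>" and \<kappa>': "\<kappa>' \<inter> \<kappa> = {}"
  shows "facet_path (d - card \<kappa>) (link K \<kappa>) (map (\<lambda>\<sigma>. \<sigma> - \<kappa>) \<gamma>)"
    "\<forall>\<rho>\<in>set (map (\<lambda>\<sigma>. \<sigma> - \<kappa>) \<gamma>). \<kappa>' \<subseteq> \<rho>"
    "map (\<lambda>\<rho>. \<rho> \<union> \<kappa>) (map (\<lambda>\<sigma>. \<sigma> - \<kappa>) \<gamma>) = \<gamma>"
proof -
  have \<gamma>': "facet_path d K \<gamma>" "\<forall>\<sigma>\<in>set \<gamma>. \<kappa>' \<union> \<kappa> \<subseteq> \<sigma>"
    using \<gamma> by (auto simp: facet_path_star[OF K])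
  show m: "map (\<lambda>\<rho>. \<rho> \<union> \<kappa>) (map (\<lambda>\<sigma>. \<sigma> - \<kappa>) \<gamma>) = \<gamma>"
    unfolding map_map using \<gamma>'(2) by (intro map_idI) auto
  show "facet_path (d - card \<kappa>) (link K \<kappa>) (map (\<lambda>\<sigma>. \<sigma> - \<kappa>) \<gamma>)"
    unfolding facet_path_link[OF K(1) \<kappa>] m using \<gamma>'(1) by auto
  show "\<forall>\<rho>\<in>set (map (\<lambda>\<sigma>. \<sigma> - \<kappa>) \<gamma>). \<kappa>' \<subseteq> \<rho>"
    using \<gamma>'(2) \<kappa>' by auto
qed

lemma locally_strongly_connected_link:
  assumes K: "abstract_complex K" "pure_complex d K" and \<kappa>: "\<kappa> \<in> K" "card \<kappa> < d"
    and sc: "locally_strongly_connected d K"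
  shows "locally_strongly_connected (d - card \<kappa>) (link K \<kappa>)"
  unfolding locally_strongly_connected_def strongly_connected_def
proof (intro ballI)
  fix \<kappa>' \<rho> \<tau>
  note L = abstract_complex_link[OF K(1), of \<kappa>] pure_complex_link[OF K \<kappa>(1) less_imp_le[OF \<kappa>(2)]]
  assume \<kappa>': "\<kappa>' \<in> link K \<kappa>" and "\<rho> \<in> facets (d - card \<kappa>) (star (link K \<kappa>) \<kappa>')"
    "\<tau> \<in> facets (d - card \<kappa>) (star (link K \<kappa>) \<kappa>')"
  then have \<rho>: "\<rho> \<inter> \<kappa> = {}" "\<rho> \<union> \<kappa> \<in> facets d K" "\<kappa>' \<subseteq> \<rho>"
    and \<tau>: "\<tau> \<inter> \<kappa> = {}" "\<tau> \<union> \<kappa> \<in> facets d K" "\<kappa>' \<subseteq> \<tau>"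
    using \<kappa> by (auto simp: facets_star[OF L] facets_link[OF K(1)])
  have k: "\<kappa>' \<union> \<kappa> \<in> K" "\<kappa>' \<inter> \<kappa> = {}" using \<kappa>' by (auto simp: link_def)
  have "\<rho> \<union> \<kappa> \<in> facets d (star K (\<kappa>' \<union> \<kappa>))" "\<tau> \<union> \<kappa> \<in> facets d (star K (\<kappa>' \<union> \<kappa>))"
    using \<rho> \<tau> by (auto simp: facets_star[OF K])
  then obtain \<gamma> where \<gamma>: "facet_path d (star K (\<kappa>' \<union> \<kappa>)) \<gamma>" "hd \<gamma> = \<rho> \<union> \<kappa>" "last \<gamma> = \<tau> \<union> \<kappa>"
    using sc k(1) unfolding locally_strongly_connected_def strongly_connected_def by meson
  have "hd (map (\<lambda>\<sigma>. \<sigma> - \<kappa>) \<gamma>) = \<rho>" "last (map (\<lambda>\<sigma>. \<sigma> - \<kappa>) \<gamma>) = \<tau>"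
    using \<gamma> facet_path_nonempty[OF \<gamma>(1)] \<rho>(1) \<tau>(1) by (auto simp: hd_map last_map)
  then show "\<exists>\<gamma>. facet_path (d - card \<kappa>) (star (link K \<kappa>) \<kappa>') \<gamma> \<and> hd \<gamma> = \<rho> \<and> last \<gamma> = \<tau>"
    using facet_path_link_of_star(1,2)[OF K \<kappa> \<gamma>(1) k(2)] facet_path_star[OF L] by blast
qed

lemma transport_link:
  "transport (\<lambda>\<rho> \<tau>. T (\<rho> \<union> \<kappa>) (\<tau> \<union> \<kappa>)) \<gamma> x = transport T (map (\<lambda>\<rho>. \<rho> \<union> \<kappa>) \<gamma>) x"
  by (induction \<gamma> arbitrary: x rule: induced_path.induct) auto

context facet_transport
begin

lemma facet_transport_link:
  assumes \<kappa>: "\<kappa> \<in> K" "card \<kappa> < d"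
  shows "facet_transport (d - card \<kappa>) (link K \<kappa>) (\<lambda>\<rho>. F (\<rho> \<union> \<kappa>)) (\<lambda>\<rho> \<tau>. T (\<rho> \<union> \<kappa>) (\<tau> \<union> \<kappa>))"
proof
  show "abstract_complex (link K \<kappa>)" by (rule abstract_complex_link[OF K(1)])
  show "pure_complex (d - card \<kappa>) (link K \<kappa>)"
    using pure_complex_link[OF K] \<kappa> by simp
qed (auto simp: neighbors_link[OF K(1) \<kappa>] T_mem T_inverse)

text \<open>The local system restricts to the link of \<open>\<kappa>\<close>.  Flatness at a vertex \<open>v\<close> of the link is flatness at
\<open>insert v \<kappa>\<close>, and every facet loop of the simply connected link is null-homotopic.\<close>

lemma flat_at_from_link:
  assumes nice: "nice_complex d K" and \<kappa>: "\<kappa> \<in> K" "codim d \<kappa> > 2"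
    and IH: "\<And>v. v \<notin> \<kappa> \<Longrightarrow> insert v \<kappa> \<in> K \<Longrightarrow> flat_at (insert v \<kappa>)"
  shows "flat_at \<kappa>"
proof -
  have c: "card \<kappa> < d" using \<kappa>(2) by (auto simp: codim_def face_dim_def)
  let ?e = "d - card \<kappa>" and ?L = "link K \<kappa>"
  interpret L: facet_transport ?e ?L "\<lambda>\<rho>. F (\<rho> \<union> \<kappa>)" "\<lambda>\<rho> \<tau>. T (\<rho> \<union> \<kappa>) (\<tau> \<union> \<kappa>)"
    by (rule facet_transport_link[OF \<kappa>(1) c])
  have "L.flat_at {v}" if v: "v \<in> \<Union>?L" for v
  proof -
    have "v \<notin> \<kappa>" "insert v \<kappa> \<in> K"
      using v subface[OF K(1), of _ "insert v \<kappa>"] by (auto simp: link_def)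
    then have flat: "flat_at (insert v \<kappa>)" by (rule IH)
    show ?thesis unfolding L.flat_at_def
    proof (intro allI ballI impI)
      fix \<gamma> x assume x: "x \<in> F (hd \<gamma> \<union> \<kappa>)" and "facet_loop ?e (star ?L {v}) (hd \<gamma>) \<gamma>"
      then have \<gamma>: "facet_path ?e ?L \<gamma>" "\<forall>\<rho>\<in>set \<gamma>. v \<in> \<rho>" "last \<gamma> = hd \<gamma>"
        by (auto simp: facet_loop_def facet_path_star[OF L.K])
      let ?\<delta> = "map (\<lambda>\<rho>. \<rho> \<union> \<kappa>) \<gamma>"
      have ne: "\<gamma> \<noteq> []" using facet_path_nonempty[OF \<gamma>(1)] .
      have "facet_path d K ?\<delta>" "\<forall>\<sigma>\<in>set ?\<delta>. insert v \<kappa> \<subseteq> \<sigma>"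
        using \<gamma> by (auto simp: facet_path_link[OF K(1) \<kappa>(1) c])
      then have "facet_loop d (star K (insert v \<kappa>)) (hd ?\<delta>) ?\<delta>"
        using \<gamma>(3) ne by (simp add: facet_loop_def facet_path_star[OF K] hd_map last_map)
      then have "transport T ?\<delta> x = x"
        using flat x ne unfolding flat_at_def by (simp add: hd_map)
      then show "transport (\<lambda>\<rho> \<tau>. T (\<rho> \<union> \<kappa>) (\<tau> \<union> \<kappa>)) \<gamma> x = x" by (simp add: transport_link)
    qed
  qed
  then interpret L: vertex_flat_transport ?e ?L "\<lambda>\<rho>. F (\<rho> \<union> \<kappa>)" "\<lambda>\<rho> \<tau>. T (\<rho> \<union> \<kappa>) (\<tau> \<union> \<kappa>)"
    using locally_strongly_connected_link[OF K \<kappa>(1) c] nice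
    by unfold_locales (auto simp: nice_complex_def)
  show ?thesis unfolding flat_at_def
  proof (intro allI ballI impI)
    fix \<gamma> x assume x: "x \<in> F (hd \<gamma>)" and \<gamma>: "facet_loop d (star K \<kappa>) (hd \<gamma>) \<gamma>"
    let ?\<delta> = "map (\<lambda>\<sigma>. \<sigma> - \<kappa>) \<gamma>"
    have "facet_path d (star K ({} \<union> \<kappa>)) \<gamma>" using \<gamma> by (simp add: facet_loop_def)
    note \<delta> = facet_path_link_of_star[OF K \<kappa>(1) c this]
    have ne: "\<gamma> \<noteq> []" using \<gamma> facet_path_nonempty by (auto simp: facet_loop_def)
    have "facet_loop ?e ?L (hd ?\<delta>) ?\<delta>"
      using \<delta>(1) \<gamma> ne by (simp add: facet_loop_def hd_map last_map)
    then have "null_homotopic_facet_loop ?e ?L (hd ?\<delta>) ?\<delta>"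
      using simply_connected_null_homotopic[OF L.K(1)] nice \<kappa>
      by (auto simp: nice_complex_def locally_strongly_simply_connected_def)
    moreover have "hd ?\<delta> \<union> \<kappa> = hd \<gamma>"
      using \<delta>(3) ne by (metis Int_empty_left hd_map list.map_disc_iff)
    ultimately have "transport (\<lambda>\<rho> \<tau>. T (\<rho> \<union> \<kappa>) (\<tau> \<union> \<kappa>)) ?\<delta> x = x"
      using L.transport_null_homotopic x by simp
    then show "transport T \<gamma> x = x" unfolding transport_link using \<delta>(3) by simp
  qed
qed

lemma flat_at_faces:
  assumes nice: "nice_complex d K"
    and low: "\<And>\<kappa>. \<kappa> \<in> K \<Longrightarrow> codim d \<kappa> \<le> 2 \<Longrightarrow> flat_at \<kappa>"
  shows "\<kappa> \<in> K \<Longrightarrow> flat_at \<kappa>"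
proof (induction "codim d \<kappa>" arbitrary: \<kappa> rule: less_induct)
  case less
  show ?case
  proof (cases "codim d \<kappa> \<le> 2")
    case False
    have "codim d (insert v \<kappa>) < codim d \<kappa>" if "v \<notin> \<kappa>" for v
    proof -
      have "finite \<kappa>" "card \<kappa> > 0"
        using less.prems finite_face[OF K(1)] nonempty_face[OF K(1)] by (auto simp: card_gt_0_iff)
      then show ?thesis using that False by (auto simp: codim_def face_dim_def)
    qed
    then show ?thesis
      using flat_at_from_link[OF nice less.prems] less.hyps False by simp
  qed (rule low[OF less.prems])
qed

theorem transport_null_homotopic_nice:
  assumes "nice_complex d K"
    and "\<And>\<kappa>. \<kappa> \<in> K \<Longrightarrow> codim d \<kappa> \<le> 2 \<Longrightarrow> flat_at \<kappa>"
    and "null_homotopic_facet_loop d K \<sigma> \<gamma>" and "x \<in> F \<sigma>"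
  shows "transport T \<gamma> x = x"
proof -
  have "flat_at {v}" if "v \<in> \<Union>K" for v
    using flat_at_faces[OF assms(1,2)] that subface[OF K(1), of _ "{v}"] by auto
  then interpret vertex_flat_transport d K F T
    using assms(1) by unfold_locales (auto simp: nice_complex_def)
  show ?thesis by (rule transport_null_homotopic[OF assms(3,4)])
qed

end

section \<open>Projectivities\<close>

lemma facet_diff_singleton:
  assumes K: "abstract_complex K" and n: "neighbors d K \<sigma> \<tau>"
  obtains w where "\<tau> - \<sigma> = {w}"
proof -
  have "\<tau> \<in> K" "card \<tau> = Suc d" "card (\<sigma> \<inter> \<tau>) = d"
    using n neighbors_iff[OF K] facets_iff[OF K] by auto
  then have "card (\<tau> - \<sigma>) = 1"
    using finite_face[OF K] card_Diff_subset_Int[of \<tau> \<sigma>] by (simp add: Int_commute)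
  then show thesis using that by (meson card_1_singletonE)
qed

lemma perspectivity_common: "v \<in> \<sigma> \<Longrightarrow> v \<in> \<tau> \<Longrightarrow> perspectivity \<sigma> \<tau> v = v"
  by (simp add: perspectivity_def)

lemma perspectivity_other:
  assumes K: "abstract_complex K" and n: "neighbors d K \<sigma> \<tau>" and v: "v \<in> \<sigma>" "v \<notin> \<tau>"
  shows "perspectivity \<sigma> \<tau> v \<in> \<tau> - \<sigma>"
proof -
  obtain w where "\<tau> - \<sigma> = {w}" by (rule facet_diff_singleton[OF K n])
  then show ?thesis using v by (simp add: perspectivity_def)
qed

lemma perspectivity_mem:
  "abstract_complex K \<Longrightarrow> neighbors d K \<sigma> \<tau> \<Longrightarrow> v \<in> \<sigma> \<Longrightarrow> perspectivity \<sigma> \<tau> v \<in> \<tau>"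
  using perspectivity_common perspectivity_other by (metis DiffD1)

lemma perspectivity_inverse:
  assumes K: "abstract_complex K" and n: "neighbors d K \<sigma> \<tau>" and v: "v \<in> \<sigma>"
  shows "perspectivity \<tau> \<sigma> (perspectivity \<sigma> \<tau> v) = v"
proof (cases "v \<in> \<tau>")
  case True then show ?thesis using v by (simp add: perspectivity_common)
next
  case False
  have n': "neighbors d K \<tau> \<sigma>" using n by (rule neighbors_sym)
  have "perspectivity \<sigma> \<tau> v \<in> \<tau> - \<sigma>" using perspectivity_other[OF K n v False] .
  then have "perspectivity \<tau> \<sigma> (perspectivity \<sigma> \<tau> v) \<in> \<sigma> - \<tau>"
    using perspectivity_other[OF K n'] by auto
  moreover obtain u where "\<sigma> - \<tau> = {u}" by (rule facet_diff_singleton[OF K n'])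
  ultimately show ?thesis using v False by (metis DiffI singletonD)
qed

lemma projectivity_extensional: "\<gamma> \<noteq> [] \<Longrightarrow> projectivity \<gamma> \<in> extensional (hd \<gamma>)"
  by (cases \<gamma> rule: projectivity.cases) (auto simp: compose_def)

lemma projectivity_mem:
  assumes K: "abstract_complex K"
  shows "facet_path d K \<gamma> \<Longrightarrow> v \<in> hd \<gamma> \<Longrightarrow> projectivity \<gamma> v \<in> last \<gamma>"
  by (induction \<gamma> arbitrary: v rule: projectivity.induct)
    (auto simp: compose_def perspectivity_mem[OF K])

lemma projectivity_append:
  assumes K: "abstract_complex K"
  shows "facet_path d K \<alpha> \<Longrightarrow> facet_path d K \<beta> \<Longrightarrow> last \<alpha> = hd \<beta> \<Longrightarrow> v \<in> hd \<alpha> \<Longrightarrow>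
    projectivity (\<alpha> @ tl \<beta>) v = projectivity \<beta> (projectivity \<alpha> v)"
proof (induction \<alpha> arbitrary: v rule: projectivity.induct)
  case (2 \<sigma>) then show ?case by (cases \<beta>) auto
next
  case (3 \<sigma> \<tau> \<gamma>) then show ?case by (auto simp: compose_def perspectivity_mem[OF K])
qed auto

lemma projectivity_rev:
  assumes K: "abstract_complex K"
  shows "facet_path d K \<gamma> \<Longrightarrow> v \<in> hd \<gamma> \<Longrightarrow> projectivity (rev \<gamma>) (projectivity \<gamma> v) = v"
proof (induction \<gamma> arbitrary: v rule: projectivity.induct)
  case (3 \<sigma> \<tau> \<gamma>)
  then have n: "neighbors d K \<sigma> \<tau>" and p: "facet_path d K (\<tau> # \<gamma>)" and v: "v \<in> \<sigma>" by auto
  let ?w = "perspectivity \<sigma> \<tau> v"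
  have w: "?w \<in> \<tau>" by (rule perspectivity_mem[OF K n v])
  have IH: "projectivity (rev (\<tau> # \<gamma>)) (projectivity (\<tau> # \<gamma>) ?w) = ?w" using 3 w by simp
  have ne: "rev (\<tau> # \<gamma>) \<noteq> []" by simp
  have "projectivity (rev (\<tau> # \<gamma>) @ tl [\<tau>, \<sigma>]) (projectivity (\<tau> # \<gamma>) ?w) =
      projectivity [\<tau>, \<sigma>] (projectivity (rev (\<tau> # \<gamma>)) (projectivity (\<tau> # \<gamma>) ?w))"
  proof (rule projectivity_append[OF K facet_path_rev[OF p]])
    show "facet_path d K [\<tau>, \<sigma>]" using neighbors_sym[OF n] by (auto simp: neighbors_def)
    show "projectivity (\<tau> # \<gamma>) ?w \<in> hd (rev (\<tau> # \<gamma>))"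
      using projectivity_mem[OF K p, of ?w] w by (simp only: hd_rev list.sel)
  qed simp
  also have "\<dots> = v"
    unfolding IH using w perspectivity_inverse[OF K n v] v by (simp add: compose_def)
  finally show ?case using v by (simp add: compose_def)
qed auto

text \<open>The reversed path provides the inverse map.\<close>

lemma projectivity_loop_Bij:
  assumes K: "abstract_complex K" and \<gamma>: "facet_loop d K \<sigma> \<gamma>"
  shows "projectivity \<gamma> \<in> Bij \<sigma>"
proof -
  have p: "facet_path d K \<gamma>" "hd \<gamma> = \<sigma>" "last \<gamma> = \<sigma>" "\<gamma> \<noteq> []"
    using \<gamma> facet_path_nonempty by (auto simp: facet_loop_def)
  have r: "facet_path d K (rev \<gamma>)" "hd (rev \<gamma>) = \<sigma>" "last (rev \<gamma>) = \<sigma>"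
    using p facet_path_rev by (auto simp: hd_rev last_rev)
  have "bij_betw (projectivity \<gamma>) \<sigma> \<sigma>"
  proof (rule bij_betw_byWitness[where f' = "projectivity (rev \<gamma>)"])
    show "\<forall>v\<in>\<sigma>. projectivity (rev \<gamma>) (projectivity \<gamma> v) = v"
      using projectivity_rev[OF K p(1)] p by auto
    show "\<forall>v\<in>\<sigma>. projectivity \<gamma> (projectivity (rev \<gamma>) v) = v"
      using projectivity_rev[OF K r(1)] r by auto
    show "projectivity \<gamma> ` \<sigma> \<subseteq> \<sigma>" using projectivity_mem[OF K p(1)] p by auto
    show "projectivity (rev \<gamma>) ` \<sigma> \<subseteq> \<sigma>" using projectivity_mem[OF K r(1)] r by auto
  qed
  then show ?thesis using projectivity_extensional p by (auto simp: Bij_def)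
qed

lemma facet_path_conjugate:
  assumes g: "facet_path d K g" and l: "facet_loop d K (last g) l"
  shows "facet_loop d K (hd g) (g @ tl l @ tl (rev g))"
proof -
  have l': "facet_path d K l" "hd l = last g" "last l = last g" using l by (auto simp: facet_loop_def)
  have ne: "g \<noteq> []" "l \<noteq> []" using facet_path_nonempty g l' by auto
  have gl: "facet_path d K (g @ tl l)" by (rule facet_path_append[OF g l'(1)]) (simp add: l')
  have e: "hd (g @ tl l) = hd g" "last (g @ tl l) = last g"
    using hd_last_append_tl[OF ne] l' by auto
  have j: "last (g @ tl l) = hd (rev g)" using ne e by (simp add: hd_rev)
  have "facet_path d K ((g @ tl l) @ tl (rev g))"
    by (rule facet_path_append[OF gl facet_path_rev[OF g] j])
  moreover have "hd ((g @ tl l) @ tl (rev g)) = hd g" "last ((g @ tl l) @ tl (rev g)) = hd g"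
    using hd_last_append_tl[of "g @ tl l" "rev g"] ne e j by (auto simp: last_rev)
  ultimately show ?thesis by (simp add: facet_loop_def)
qed

lemma projectivity_conjugate:
  assumes K: "abstract_complex K" and g: "facet_path d K g" and l: "facet_loop d K (last g) l"
    and v: "v \<in> hd g"
  shows "projectivity (g @ tl l @ tl (rev g)) v =
    projectivity (rev g) (projectivity l (projectivity g v))"
proof -
  have l': "facet_path d K l" "hd l = last g" "last l = last g" using l by (auto simp: facet_loop_def)
  have ne: "g \<noteq> []" "l \<noteq> []" using facet_path_nonempty g l' by auto
  have gl: "facet_path d K (g @ tl l)" by (rule facet_path_append[OF g l'(1)]) (simp add: l')
  have e: "hd (g @ tl l) = hd g" "last (g @ tl l) = hd (rev g)"
    using hd_last_append_tl[OF ne] l' ne by (auto simp: hd_rev)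
  have "projectivity ((g @ tl l) @ tl (rev g)) v = projectivity (rev g) (projectivity (g @ tl l) v)"
    using e v by (intro projectivity_append[OF K gl facet_path_rev[OF g]]) auto
  also have "projectivity (g @ tl l) v = projectivity l (projectivity g v)"
    using l' v by (intro projectivity_append[OF K g]) auto
  finally show ?thesis by simp
qed

section \<open>Projectivities in the star of a face\<close>

text \<open>No perspectivity in the star moves a vertex of \<open>\<kappa>\<close>, hence by injectivity no other vertex is sent
into \<open>\<kappa>\<close>.\<close>

lemma star_loop_projectivity:
  assumes K: "abstract_complex K" "pure_complex d K" and l: "facet_loop d (star K \<kappa>) \<sigma> l"
  shows "facet_loop d K \<sigma> l" "\<kappa> \<subseteq> \<sigma>"
    and "\<And>v. v \<in> \<kappa> \<Longrightarrow> projectivity l v = v"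
    and "\<And>v. v \<in> \<sigma> - \<kappa> \<Longrightarrow> projectivity l v \<in> \<sigma> - \<kappa>"
proof -
  have l': "facet_path d K l" "\<forall>\<rho>\<in>set l. \<kappa> \<subseteq> \<rho>" "hd l = \<sigma>" "last l = \<sigma>"
    using l by (auto simp: facet_loop_def facet_path_star[OF K])
  then show loop: "facet_loop d K \<sigma> l" by (simp add: facet_loop_def)
  show \<kappa>\<sigma>: "\<kappa> \<subseteq> \<sigma>" using l' facet_path_nonempty by (metis hd_in_set)
  show fix\<kappa>: "projectivity l v = v" if v: "v \<in> \<kappa>" for v
    using l'(1,2)
    by (induction l rule: projectivity.induct) (use v in \<open>auto simp: compose_def perspectivity_common subset_iff\<close>)
  have "bij_betw (projectivity l) \<sigma> \<sigma>" using projectivity_loop_Bij[OF K(1) loop] by (simp add: Bij_def)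
  then have inj: "inj_on (projectivity l) \<sigma>" and im: "projectivity l ` \<sigma> = \<sigma>"
    by (auto simp: bij_betw_def)
  fix v assume v: "v \<in> \<sigma> - \<kappa>"
  have "projectivity l v \<notin> \<kappa>"
  proof
    assume k: "projectivity l v \<in> \<kappa>"
    then have "projectivity l (projectivity l v) = projectivity l v" by (rule fix\<kappa>)
    then have "projectivity l v = v" using inj v k \<kappa>\<sigma> by (meson DiffD1 inj_onD subsetD)
    then show False using k v by simp
  qed
  then show "projectivity l v \<in> \<sigma> - \<kappa>" using im v by auto
qed

lemma facet_minus_codim2:
  assumes K: "abstract_complex K" and \<sigma>: "\<sigma> \<in> facets d K" "\<kappa> \<subseteq> \<sigma>" and \<kappa>: "\<kappa> \<in> K" "codim d \<kappa> = 2"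
  shows "card (\<sigma> - \<kappa>) = 2"
proof -
  have "card \<kappa> > 0" using \<kappa>(1) finite_face[OF K] nonempty_face[OF K] by (auto simp: card_gt_0_iff)
  then have "card \<kappa> = d - 1" "d \<ge> 2" using \<kappa>(2) by (auto simp: codim_def face_dim_def)
  then show ?thesis
    using \<sigma> finite_face[OF K \<kappa>(1)] facets_iff[OF K] by (simp add: card_Diff_subset)
qed

lemma projectivity_codim_le_1:
  assumes K: "abstract_complex K" "pure_complex d K" and \<kappa>: "\<kappa> \<in> K" "codim d \<kappa> \<le> 1"
    and l: "facet_loop d (star K \<kappa>) \<sigma> l" and v: "v \<in> \<sigma>"
  shows "projectivity l v = v"
proof (cases "v \<in> \<kappa>")
  case True then show ?thesis using star_loop_projectivity(3)[OF K l] by simp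
next
  case False
  note s = star_loop_projectivity[OF K l]
  have "card \<kappa> > 0" using \<kappa>(1) finite_face[OF K(1)] nonempty_face[OF K(1)] by (auto simp: card_gt_0_iff)
  then have "card \<kappa> \<ge> d" using \<kappa>(2) by (auto simp: codim_def face_dim_def)
  moreover have "hd l \<in> facets d K" "hd l = \<sigma>"
    using s(1) hd_facet by (auto simp: facet_loop_def)
  then have \<sigma>: "finite \<sigma>" "card \<sigma> = Suc d" using finite_face[OF K(1)] facets_iff[OF K(1)] by auto
  ultimately have "card (\<sigma> - \<kappa>) \<le> 1" using s(2) by (simp add: card_Diff_subset finite_subset)
  then have "x = y" if "x \<in> \<sigma> - \<kappa>" "y \<in> \<sigma> - \<kappa>" for x y
    using that card_le_Suc0_iff_eq[of "\<sigma> - \<kappa>"] \<sigma> by auto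
  then show ?thesis using s(4)[of v] v False by auto
qed

text \<open>A perspectivity in the star exchanges one end of a link edge and keeps the other one, so it
preserves a 2-colouring of the link.  A colour-preserving permutation of the two vertices of
\<open>\<sigma> - \<kappa>\<close> is trivial.\<close>

lemma projectivity_even:
  assumes K: "abstract_complex K" "pure_complex d K" and \<kappa>: "\<kappa> \<in> K" "codim d \<kappa> = 2" "\<not> odd_face K \<kappa>"
    and l: "facet_loop d (star K \<kappa>) \<sigma> l" and v: "v \<in> \<sigma>"
  shows "projectivity l v = v"
proof (cases "v \<in> \<kappa>")
  case True then show ?thesis using star_loop_projectivity(3)[OF K l] by simp
next
  case False
  note s = star_loop_projectivity[OF K l]
  obtain A B where AB: "A \<inter> B = {}"
    "\<forall>u v. {u, v} \<in> link K \<kappa> \<and> u \<noteq> v \<longrightarrow> (u \<in> A \<and> v \<in> B) \<or> (u \<in> B \<and> v \<in> A)"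
    using \<kappa>(3) unfolding odd_face_def bipartite_graph_def not_not by (elim exE conjE) (rule that)
  have edge: "\<rho> - \<kappa> = {u, w} \<and> (u \<in> A \<longleftrightarrow> w \<notin> A)"
    if "\<rho> \<in> facets d K" "\<kappa> \<subseteq> \<rho>" "u \<in> \<rho> - \<kappa>" "w \<in> \<rho> - \<kappa>" "u \<noteq> w" for \<rho> u w
  proof -
    have "card (\<rho> - \<kappa>) = 2" by (rule facet_minus_codim2[OF K(1) that(1,2) \<kappa>(1,2)])
    moreover from this have "finite (\<rho> - \<kappa>)" by (intro card_ge_0_finite) simp
    ultimately have e: "\<rho> - \<kappa> = {u, w}"
      using that card_subset_eq[of "\<rho> - \<kappa>" "{u, w}"] by simp
    have "\<rho> \<in> K" using that facets_iff[OF K(1)] by auto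
    moreover have "{u, w} \<union> \<kappa> = \<rho>" using e that by auto
    ultimately have "{u, w} \<in> link K \<kappa>"
      using that subface[OF K(1), of \<rho> "{u, w}"] by (auto simp: link_def)
    then show ?thesis using AB that e by blast
  qed
  have step: "perspectivity \<rho> \<tau> u \<in> A \<longleftrightarrow> u \<in> A"
    if n: "neighbors d K \<rho> \<tau>" and k: "\<kappa> \<subseteq> \<rho>" "\<kappa> \<subseteq> \<tau>" and u: "u \<in> \<rho>" for \<rho> \<tau> u
  proof (cases "u \<in> \<tau>")
    case True then show ?thesis using u by (simp add: perspectivity_common)
  next
    case False
    have f: "\<rho> \<in> facets d K" "\<tau> \<in> facets d K" using n by (auto simp: neighbors_def)
    have "card (\<rho> - \<kappa>) = 2" by (rule facet_minus_codim2[OF K(1) f(1) k(1) \<kappa>(1,2)])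
    then obtain w where w: "w \<in> \<rho> - \<kappa>" "w \<noteq> u" by (auto simp: card_2_iff)
    obtain u' where "\<rho> - \<tau> = {u'}" by (rule facet_diff_singleton[OF K(1) neighbors_sym[OF n]])
    then have wt: "w \<in> \<tau>" using False w u by (metis DiffD1 DiffI singletonD)
    have p: "perspectivity \<rho> \<tau> u \<in> \<tau> - \<rho>" by (rule perspectivity_other[OF K(1) n u False])
    have "u \<in> A \<longleftrightarrow> w \<notin> A" using edge[OF f(1) k(1), of u w] u w False k by auto
    moreover have "perspectivity \<rho> \<tau> u \<in> A \<longleftrightarrow> w \<notin> A"
      using edge[OF f(2) k(2), of "perspectivity \<rho> \<tau> u" w] p w wt k by auto
    ultimately show ?thesis by blast
  qed
  have colour: "projectivity m u \<in> A \<longleftrightarrow> u \<in> A"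
    if "facet_path d K m" "\<forall>\<rho>\<in>set m. \<kappa> \<subseteq> \<rho>" "u \<in> hd m" for m u
    using that by (induction m arbitrary: u rule: projectivity.induct)
      (auto simp: compose_def step perspectivity_mem[OF K(1)])
  have l': "facet_path d K l" "\<forall>\<rho>\<in>set l. \<kappa> \<subseteq> \<rho>" "hd l = \<sigma>" "last l = \<sigma>"
    using l by (auto simp: facet_loop_def facet_path_star[OF K])
  show ?thesis
  proof (rule ccontr)
    assume "projectivity l v \<noteq> v"
    then have "v \<in> A \<longleftrightarrow> projectivity l v \<notin> A"
      using edge[of \<sigma> v "projectivity l v"] s(2,4) v False hd_facet[OF l'(1)] l'(3) by auto
    then show False using colour[OF l'(1,2), of v] v l'(3) by auto
  qed
qed

text \<open>Only the two vertices of \<open>\<sigma> - \<kappa>\<close> can move.\<close>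

lemma projectivity_codim_2:
  assumes K: "abstract_complex K" "pure_complex d K" and \<kappa>: "\<kappa> \<in> K" "codim d \<kappa> = 2"
    and l: "facet_loop d (star K \<kappa>) \<sigma> l"
  shows "(\<forall>v\<in>\<sigma>. projectivity l v = v) \<or>
    (\<exists>a\<in>\<sigma>. \<exists>b\<in>\<sigma>. a \<noteq> b \<and> (\<forall>v\<in>\<sigma>. projectivity l v = Transposition.transpose a b v))"
proof -
  note s = star_loop_projectivity[OF K l]
  have "hd l \<in> facets d K" "hd l = \<sigma>"
    using s(1) hd_facet by (auto simp: facet_loop_def)
  then have "card (\<sigma> - \<kappa>) = 2" using facet_minus_codim2[OF K(1) _ s(2) \<kappa>] by simp
  then obtain a b where ab: "\<sigma> - \<kappa> = {a, b}" "a \<noteq> b" by (auto simp: card_2_iff)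
  have inj: "inj_on (projectivity l) \<sigma>"
    using projectivity_loop_Bij[OF K(1) s(1)] by (simp add: Bij_def bij_betw_def)
  have m: "a \<in> \<sigma>" "b \<in> \<sigma>" "a \<notin> \<kappa>" "b \<notin> \<kappa>" using ab by auto
  have "projectivity l a \<in> {a, b}" "projectivity l b \<in> {a, b}" using s(4) ab by auto
  moreover have "projectivity l a \<noteq> projectivity l b" using inj m ab(2) by (meson inj_onD)
  ultimately consider "projectivity l a = a" "projectivity l b = b"
    | "projectivity l a = b" "projectivity l b = a" by auto
  then show ?thesis
  proof cases
    case 1
    have "projectivity l v = v" if "v \<in> \<sigma>" for v
    proof (cases "v \<in> \<kappa>")
      case False then have "v \<in> {a, b}" using that ab(1) by blast
      then show ?thesis using 1 by auto
    qed (rule s(3))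
    then show ?thesis by blast
  next
    case 2
    have "projectivity l v = Transposition.transpose a b v" if "v \<in> \<sigma>" for v
    proof (cases "v \<in> \<kappa>")
      case True then show ?thesis using s(3) m by (auto simp: Transposition.transpose_def)
    next
      case False then have "v \<in> {a, b}" using that ab(1) by blast
      then show ?thesis using 2 by (auto simp: Transposition.transpose_def)
    qed
    then show ?thesis using m ab(2) by blast
  qed
qed

text \<open>Conjugates of transpositions are transpositions.\<close>

lemma projectivities_around_transpositions:
  assumes K: "abstract_complex K" "pure_complex d K" and \<kappa>: "\<kappa> \<in> K" "codim d \<kappa> = 2"
  shows "projectivities_around d K \<sigma>0 \<kappa> \<subseteq> insert (\<lambda>v\<in>\<sigma>0. v) (transpositions \<sigma>0)"
proof
  fix p assume "p \<in> projectivities_around d K \<sigma>0 \<kappa>"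
  then obtain g l where p: "p = projectivity (g @ tl l @ tl (rev g))"
    and g: "facet_path d K g" "hd g = \<sigma>0" and l: "facet_loop d (star K \<kappa>) (last g) l"
    by (auto simp: projectivities_around_def)
  note lK = star_loop_projectivity(1)[OF K l]
  note c = facet_path_conjugate[OF g(1) lK]
  have p_ext: "p \<in> extensional \<sigma>0"
    using projectivity_loop_Bij[OF K(1) c] g(2) p by (simp add: Bij_def)
  have pv: "p v = projectivity (rev g) (projectivity l (projectivity g v))" if "v \<in> \<sigma>0" for v
    using projectivity_conjugate[OF K(1) g(1) lK] that g(2) p by simp
  have r: "facet_path d K (rev g)" "hd (rev g) = last g" "last (rev g) = \<sigma>0"
    using facet_path_rev[OF g(1)] facet_path_nonempty[OF g(1)] g(2) by (auto simp: hd_rev last_rev)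
  have gr: "projectivity (rev g) (projectivity g v) = v" "projectivity g v \<in> last g" if "v \<in> \<sigma>0" for v
    using projectivity_rev[OF K(1) g(1)] projectivity_mem[OF K(1) g(1)] that g(2) by auto
  have rg: "projectivity g (projectivity (rev g) w) = w" "projectivity (rev g) w \<in> \<sigma>0" if "w \<in> last g" for w
    using projectivity_rev[OF K(1) r(1)] projectivity_mem[OF K(1) r(1)] that r by auto
  consider "\<forall>v\<in>last g. projectivity l v = v"
    | a b where "a \<in> last g" "b \<in> last g" "a \<noteq> b" "\<forall>v\<in>last g. projectivity l v = Transposition.transpose a b v"
    using projectivity_codim_2[OF K \<kappa> l] by blast
  then show "p \<in> insert (\<lambda>v\<in>\<sigma>0. v) (transpositions \<sigma>0)"
  proof cases
    case 1
    have "p v = (\<lambda>v\<in>\<sigma>0. v) v" for v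
      using 1 pv[of v] gr[of v] p_ext by (cases "v \<in> \<sigma>0") (auto simp: extensional_def)
    then show ?thesis by auto
  next
    case 2
    let ?a = "projectivity (rev g) a" and ?b = "projectivity (rev g) b"
    have ab: "?a \<in> \<sigma>0" "?b \<in> \<sigma>0" "?a \<noteq> ?b" using rg 2 by (auto, metis)
    have "p v = restrict (Transposition.transpose ?a ?b) \<sigma>0 v" for v
    proof (cases "v \<in> \<sigma>0")
      case True
      consider "v = ?a" | "v = ?b" | "v \<noteq> ?a" "v \<noteq> ?b" by blast
      then show ?thesis
      proof cases
        case 3
        then have "projectivity g v \<noteq> a" "projectivity g v \<noteq> b" using gr(1)[OF True] by auto
        then show ?thesis using 3 2(4) gr[OF True] pv[OF True] True by (simp add: Transposition.transpose_def)
      qed (use pv[OF True] rg(1) 2 True in \<open>auto simp: Transposition.transpose_def\<close>)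
    next
      case False then show ?thesis using p_ext by (auto simp: extensional_def)
    qed
    then have "p = restrict (Transposition.transpose ?a ?b) \<sigma>0" by blast
    then show ?thesis using ab unfolding transpositions_def by blast
  qed
qed

section \<open>Null-homotopic facet loops\<close>

text \<open>The two paths differ by the constant piece at the end of \<open>induced_path \<alpha>\<close> and by the placement of
brackets.\<close>

lemma induced_path_append:
  assumes K: "abstract_complex K"
  shows "facet_path d K \<alpha> \<Longrightarrow> facet_path d K \<beta> \<Longrightarrow> last \<alpha> = hd \<beta> \<Longrightarrow>
    homotopic_paths (realization K) (induced_path (\<alpha> @ tl \<beta>)) (induced_path \<alpha> +++ induced_path \<beta>)"
proof (induction \<alpha> rule: induced_path.induct)
  case (2 \<sigma>)
  then have "[\<sigma>] @ tl \<beta> = \<beta>" by (cases \<beta>) auto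
  moreover have "homotopic_paths (realization K) (induced_path \<beta>)
      ((\<lambda>_. pathstart (induced_path \<beta>)) +++ induced_path \<beta>)"
    using induced_path_props[OF K 2(2)] by (intro homotopic_paths_sym[OF homotopic_paths_join_const(2)]) auto
  ultimately show ?case using induced_path_props[OF K 2(2)] 2 by simp
next
  case (3 \<sigma> \<tau> \<gamma>)
  let ?S = "realization K" and ?P = "induced_path (\<tau> # \<gamma>)" and ?Q = "induced_path \<beta>"
  let ?s = "segment_path (barycenter \<sigma>) (barycenter (\<sigma> \<inter> \<tau>))"
    and ?t = "segment_path (barycenter (\<sigma> \<inter> \<tau>)) (barycenter \<tau>)"
  have n: "neighbors d K \<sigma> \<tau>" and path: "facet_path d K (\<tau> # \<gamma>)" using 3 by auto
  note st = path_image_crossing[OF K n]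
  note P = induced_path_props[OF K path] and Q = induced_path_props[OF K 3(3)]
  have PQ: "pathfinish ?P = pathstart ?Q" using P Q 3(4) by simp
  have "homotopic_paths ?S (induced_path ((\<tau> # \<gamma>) @ tl \<beta>)) (?P +++ ?Q)" using 3 by simp
  moreover have "pathstart (induced_path ((\<tau> # \<gamma>) @ tl \<beta>)) = barycenter \<tau>"
    by (simp add: pathstart_def pathstart_induced_path)
  ultimately have "homotopic_paths ?S (?s +++ ?t +++ induced_path ((\<tau> # \<gamma>) @ tl \<beta>)) (?s +++ ?t +++ ?P +++ ?Q)"
    using st by (intro homotopic_paths_join) auto
  also have "homotopic_paths ?S (?s +++ ?t +++ ?P +++ ?Q) (?s +++ (?t +++ ?P) +++ ?Q)"
    using st P Q PQ by (intro homotopic_paths_join homotopic_paths_assoc) auto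
  also have "homotopic_paths ?S (?s +++ (?t +++ ?P) +++ ?Q) ((?s +++ ?t +++ ?P) +++ ?Q)"
    using st P Q PQ by (intro homotopic_paths_assoc) (auto simp: subset_path_image_join)
  finally show ?case by simp
qed auto

lemma induced_path_rev:
  assumes K: "abstract_complex K"
  shows "facet_path d K \<gamma> \<Longrightarrow>
    homotopic_paths (realization K) (induced_path (rev \<gamma>)) (reversepath (induced_path \<gamma>))"
proof (induction \<gamma> rule: induced_path.induct)
  case (2 \<sigma>)
  then show ?case using induced_path_props[OF K 2] by (simp add: reversepath_def)
next
  case (3 \<sigma> \<tau> \<gamma>)
  let ?S = "realization K" and ?P = "induced_path (\<tau> # \<gamma>)"
  let ?s = "segment_path (barycenter \<sigma>) (barycenter (\<sigma> \<inter> \<tau>))"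
    and ?t = "segment_path (barycenter (\<sigma> \<inter> \<tau>)) (barycenter \<tau>)"
  let ?s' = "segment_path (barycenter (\<sigma> \<inter> \<tau>)) (barycenter \<sigma>)"
    and ?t' = "segment_path (barycenter \<tau>) (barycenter (\<sigma> \<inter> \<tau>))"
  have paths: "facet_path d K [\<tau>, \<sigma>]" "facet_path d K (\<tau> # \<gamma>)"
    using 3 neighbors_sym by (auto simp: neighbors_def)
  have i: "induced_path [\<tau>, \<sigma>] = ?t' +++ ?s' +++ (\<lambda>_. barycenter \<sigma>)" by (simp add: Int_commute)
  have "neighbors d K \<tau> \<sigma>" using 3 neighbors_sym by auto
  from path_image_crossing[OF K this] have st: "path_image ?t' \<subseteq> ?S" "path_image ?s' \<subseteq> ?S"
    by (simp_all add: Int_commute)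
  note P = induced_path_props[OF K paths(2)]
  have "homotopic_paths ?S (induced_path (rev (\<tau> # \<gamma>) @ tl [\<tau>, \<sigma>]))
      (induced_path (rev (\<tau> # \<gamma>)) +++ induced_path [\<tau>, \<sigma>])"
    by (rule induced_path_append[OF K facet_path_rev[OF paths(2)] paths(1)]) (simp add: last_rev)
  also have "homotopic_paths ?S (induced_path (rev (\<tau> # \<gamma>)) +++ induced_path [\<tau>, \<sigma>])
      (reversepath ?P +++ ?t' +++ ?s')"
  proof (rule homotopic_paths_join)
    show "homotopic_paths ?S (induced_path (rev (\<tau> # \<gamma>))) (reversepath ?P)" using 3 by simp
    have "homotopic_paths ?S (?s' +++ (\<lambda>_. pathfinish ?s')) ?s'"
      using st by (intro homotopic_paths_join_const(1)) auto
    then show "homotopic_paths ?S (induced_path [\<tau>, \<sigma>]) (?t' +++ ?s')"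
      unfolding i using st by (intro homotopic_paths_join) auto
    show "pathfinish (induced_path (rev (\<tau> # \<gamma>))) = pathstart (induced_path [\<tau>, \<sigma>])"
      using induced_path_props[OF K facet_path_rev[OF paths(2)]] induced_path_props[OF K paths(1)]
      by (simp add: last_rev)
  qed
  also have "homotopic_paths ?S (reversepath ?P +++ ?t' +++ ?s') ((reversepath ?P +++ ?t') +++ ?s')"
    using st P by (intro homotopic_paths_assoc) auto
  also have "(reversepath ?P +++ ?t') +++ ?s' = reversepath (?s +++ ?t +++ ?P)"
    using P by (simp add: reversepath_joinpaths)
  finally show ?case by simp
qed auto

lemma null_homotopic_append:
  assumes K: "abstract_complex K"
    and "null_homotopic_facet_loop d K \<sigma> \<alpha>" "null_homotopic_facet_loop d K \<sigma> \<beta>"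
  shows "null_homotopic_facet_loop d K \<sigma> (\<alpha> @ tl \<beta>)"
proof -
  have a: "facet_path d K \<alpha>" "hd \<alpha> = \<sigma>" "last \<alpha> = \<sigma>"
      "homotopic_paths (realization K) (induced_path \<alpha>) (\<lambda>_. barycenter \<sigma>)"
    and b: "facet_path d K \<beta>" "hd \<beta> = \<sigma>" "last \<beta> = \<sigma>"
      "homotopic_paths (realization K) (induced_path \<beta>) (\<lambda>_. barycenter \<sigma>)"
    using assms by (auto simp: null_homotopic_facet_loop_def facet_loop_def)
  have ab: "last \<alpha> = hd \<beta>" using a b by simp
  have "homotopic_paths (realization K) (induced_path (\<alpha> @ tl \<beta>)) (induced_path \<alpha> +++ induced_path \<beta>)"
    by (rule induced_path_append[OF K a(1) b(1) ab])
  also have "homotopic_paths (realization K) (induced_path \<alpha> +++ induced_path \<beta>)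
      ((\<lambda>_. barycenter \<sigma>) +++ (\<lambda>_. barycenter \<sigma>))"
    using a b induced_path_props[OF K a(1)] induced_path_props[OF K b(1)]
    by (intro homotopic_paths_join) auto
  also have "((\<lambda>_. barycenter \<sigma>) +++ (\<lambda>_. barycenter \<sigma>)) = (\<lambda>_::real. barycenter \<sigma>)"
    by (simp add: joinpaths_def)
  finally have "homotopic_paths (realization K) (induced_path (\<alpha> @ tl \<beta>)) (\<lambda>_. barycenter \<sigma>)" .
  moreover have "facet_loop d K \<sigma> (\<alpha> @ tl \<beta>)"
    using facet_path_append[OF a(1) b(1) ab] a b
      hd_last_append_tl[OF facet_path_nonempty[OF a(1)] facet_path_nonempty[OF b(1)] ab]
    by (simp add: facet_loop_def)
  ultimately show ?thesis by (simp add: null_homotopic_facet_loop_def)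
qed

lemma null_homotopic_rev:
  assumes K: "abstract_complex K" and \<gamma>: "null_homotopic_facet_loop d K \<sigma> \<gamma>"
  shows "null_homotopic_facet_loop d K \<sigma> (rev \<gamma>)"
proof -
  have a: "facet_path d K \<gamma>" "hd \<gamma> = \<sigma>" "last \<gamma> = \<sigma>"
      "homotopic_paths (realization K) (induced_path \<gamma>) (\<lambda>_. barycenter \<sigma>)"
    using \<gamma> by (auto simp: null_homotopic_facet_loop_def facet_loop_def)
  have "homotopic_paths (realization K) (induced_path (rev \<gamma>)) (reversepath (induced_path \<gamma>))"
    by (rule induced_path_rev[OF K a(1)])
  also have "homotopic_paths (realization K) (reversepath (induced_path \<gamma>)) (reversepath (\<lambda>_. barycenter \<sigma>))"
    using a(4) by (simp only: homotopic_paths_reversepath)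
  also have "reversepath (\<lambda>_. barycenter \<sigma>) = (\<lambda>_. barycenter \<sigma>)" by (simp add: reversepath_def)
  finally have "homotopic_paths (realization K) (induced_path (rev \<gamma>)) (\<lambda>_. barycenter \<sigma>)" .
  then show ?thesis
    using a facet_path_rev facet_path_nonempty
    by (auto simp: null_homotopic_facet_loop_def facet_loop_def hd_rev last_rev)
qed

lemma null_homotopic_conjugate:
  assumes K: "abstract_complex K" and g: "facet_path d K g"
    and l: "null_homotopic_facet_loop d K (last g) l"
  shows "null_homotopic_facet_loop d K (hd g) (g @ tl l @ tl (rev g))"
proof -
  let ?S = "realization K" and ?g = "induced_path g"
  have loop: "facet_loop d K (last g) l" and l': "facet_path d K l" "hd l = last g" "last l = last g"
      "homotopic_paths ?S (induced_path l) (\<lambda>_. barycenter (last g))"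
    using l by (auto simp: null_homotopic_facet_loop_def facet_loop_def)
  have ne: "g \<noteq> []" "l \<noteq> []" using facet_path_nonempty g l' by auto
  have gl: "facet_path d K (g @ tl l)" by (rule facet_path_append[OF g l'(1)]) (simp add: l')
  have e: "last (g @ tl l) = hd (rev g)"
    using hd_last_append_tl[OF ne] l' ne by (auto simp: hd_rev)
  note r = facet_path_rev[OF g]
  note pg = induced_path_props[OF K g] and pl = induced_path_props[OF K l'(1)]
    and pr = induced_path_props[OF K r] and pgl = induced_path_props[OF K gl]
  have "homotopic_paths ?S (induced_path ((g @ tl l) @ tl (rev g)))
      (induced_path (g @ tl l) +++ induced_path (rev g))"
    by (rule induced_path_append[OF K gl r e])
  also have "homotopic_paths ?S (induced_path (g @ tl l) +++ induced_path (rev g)) (?g +++ reversepath ?g)"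
  proof (rule homotopic_paths_join)
    have "homotopic_paths ?S (induced_path (g @ tl l)) (?g +++ induced_path l)"
      by (rule induced_path_append[OF K g l'(1)]) (simp add: l')
    also have "homotopic_paths ?S (?g +++ induced_path l) (?g +++ (\<lambda>_. pathfinish ?g))"
      using l' pg pl by (intro homotopic_paths_join) auto
    also have "homotopic_paths ?S (?g +++ (\<lambda>_. pathfinish ?g)) ?g"
      using pg by (intro homotopic_paths_join_const) auto
    finally show "homotopic_paths ?S (induced_path (g @ tl l)) ?g" .
    show "homotopic_paths ?S (induced_path (rev g)) (reversepath ?g)" by (rule induced_path_rev[OF K g])
    show "pathfinish (induced_path (g @ tl l)) = pathstart (induced_path (rev g))"
      using pgl pr e by simp
  qed
  also have "homotopic_paths ?S (?g +++ reversepath ?g) (\<lambda>_. pathstart ?g)"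
    using pg by (intro homotopic_paths_back_and_forth) auto
  finally show ?thesis
    using facet_path_conjugate[OF g loop] pg by (simp add: null_homotopic_facet_loop_def)
qed

lemma closed_simplex_mono:
  assumes "finite \<sigma>" "\<rho> \<subseteq> \<sigma>" shows "closed_simplex \<rho> \<subseteq> closed_simplex \<sigma>"
proof
  fix x assume x: "x \<in> closed_simplex \<rho>"
  have "sum x \<rho> = sum x \<sigma>"
    using assms x by (intro sum.mono_neutral_left) (auto simp: closed_simplex_def)
  then show "x \<in> closed_simplex \<sigma>" using x assms(2) by (auto simp: closed_simplex_def)
qed

text \<open>Every simplex of the star lies in a simplex that also contains the barycenter of \<open>\<kappa>\<close>, so the star is
star-shaped about it.\<close>

lemma null_homotopic_star_loop:
  assumes K: "abstract_complex K" "pure_complex d K" and \<kappa>: "\<kappa> \<in> K"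
    and l: "facet_loop d (star K \<kappa>) \<sigma> l"
  shows "null_homotopic_facet_loop d K \<sigma> l"
proof -
  let ?p = "induced_path l" and ?b = "barycenter \<kappa>"
  let ?h = "\<lambda>z :: real \<times> real. segment_path (?p (snd z)) ?b (fst z)"
  have l': "facet_path d (star K \<kappa>) l" "hd l = \<sigma>" "last l = \<sigma>"
    using l by (auto simp: facet_loop_def)
  note p = induced_path_props[OF abstract_complex_star[OF K(1)] l'(1)]
  have "homotopic_loops (realization K) ?p (\<lambda>_. ?b)"
    unfolding homotopic_loops
  proof (intro exI[of _ ?h] conjI ballI)
    have "continuous_on {0..1} (\<lambda>t. ?p t v)" for v
      by (rule continuous_on_product_then_coordinatewise) (use p in \<open>simp add: path_def\<close>)
    then have "continuous_on ({0..1} \<times> {0..1}) (\<lambda>z :: real \<times> real. ?p (snd z) v)" for v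
      by (rule continuous_on_compose2[OF _ continuous_on_snd[OF continuous_on_id]]) auto
    then show "continuous_on ({0..1} \<times> {0..1}) ?h"
      unfolding segment_path_def
      by (intro continuous_on_coordinatewise_then_product continuous_intros)
    show "?h \<in> {0..1} \<times> {0..1} \<rightarrow> realization K"
    proof
      fix z :: "real \<times> real" assume z: "z \<in> {0..1} \<times> {0..1}"
      then have "?p (snd z) \<in> realization (star K \<kappa>)"
        using p unfolding path_image_def by auto
      then obtain \<rho> \<tau> where \<tau>: "?p (snd z) \<in> closed_simplex \<rho>" "\<tau> \<in> K" "\<rho> \<subseteq> \<tau>" "\<kappa> \<subseteq> \<tau>"
        by (auto simp: realization_def star_def)
      have "?p (snd z) \<in> closed_simplex \<tau>"
        using closed_simplex_mono[of \<tau> \<rho>] \<tau> finite_face[OF K(1)] by auto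
      moreover have "?b \<in> closed_simplex \<tau>"
        using \<tau> finite_face[OF K(1)] nonempty_face[OF K(1) \<kappa>] by (intro barycenter_in_closed_simplex) auto
      ultimately have "?h z \<in> closed_simplex \<tau>"
        using z by (intro segment_path_in_closed_simplex) auto
      then show "?h z \<in> realization K" using \<tau> by (auto simp: realization_def)
    qed
  qed (use p l' in \<open>auto simp: segment_path_def pathstart_def pathfinish_def\<close>)
  from homotopic_loops_const_imp_homotopic_paths[OF this] show ?thesis
    using star_loop_projectivity(1)[OF K l] p l' by (simp add: null_homotopic_facet_loop_def)
qed

section \<open>The reduced group of projectivities\<close>

lemma BijGroup_mult: "f \<in> Bij S \<Longrightarrow> g \<in> Bij S \<Longrightarrow> f \<otimes>\<^bsub>BijGroup S\<^esub> g = compose S f g"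
  by (simp add: BijGroup_def)

lemma BijGroup_simps: "carrier (BijGroup S) = Bij S" "\<one>\<^bsub>BijGroup S\<^esub> = (\<lambda>x\<in>S. x)"
  by (simp_all add: BijGroup_def)

lemma compose_projectivity:
  assumes K: "abstract_complex K" and "facet_path d K \<alpha>" "facet_path d K \<beta>" "last \<alpha> = hd \<beta>"
  shows "compose (hd \<alpha>) (projectivity \<beta>) (projectivity \<alpha>) = projectivity (\<alpha> @ tl \<beta>)"
proof
  have ne: "\<alpha> \<noteq> []" "\<beta> \<noteq> []" using assms facet_path_nonempty by auto
  fix v show "compose (hd \<alpha>) (projectivity \<beta>) (projectivity \<alpha>) v = projectivity (\<alpha> @ tl \<beta>) v"
    using projectivity_append[OF assms, of v] projectivity_extensional[of "\<alpha> @ tl \<beta>"] ne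
    by (cases "v \<in> hd \<alpha>") (auto simp: compose_def extensional_def hd_append)
qed

text \<open>Products and inverses come from concatenation and reversal.  The product of \<^const>\<open>BijGroup\<close> is
composition from right to left, so the factors are concatenated in the opposite order.\<close>

lemma reduced_projectivities_subgroup:
  assumes K: "abstract_complex K" and \<sigma>: "\<sigma> \<in> facets d K"
  shows "subgroup (reduced_projectivities d K \<sigma>) (BijGroup \<sigma>)"
proof -
  interpret G: group "BijGroup \<sigma>" by (rule group_BijGroup)
  have loop: "facet_path d K \<gamma>" "hd \<gamma> = \<sigma>" "last \<gamma> = \<sigma>" "projectivity \<gamma> \<in> Bij \<sigma>"
    if "null_homotopic_facet_loop d K \<sigma> \<gamma>" for \<gamma>
    using that projectivity_loop_Bij[OF K] by (auto simp: null_homotopic_facet_loop_def facet_loop_def)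
  have one: "null_homotopic_facet_loop d K \<sigma> [\<sigma>]"
    using \<sigma> induced_path_props[OF K, of d "[\<sigma>]"]
    by (simp add: null_homotopic_facet_loop_def facet_loop_def)
  show ?thesis
  proof (rule G.subgroupI)
    show "reduced_projectivities d K \<sigma> \<subseteq> carrier (BijGroup \<sigma>)"
      using loop by (auto simp: reduced_projectivities_def BijGroup_simps)
    show "reduced_projectivities d K \<sigma> \<noteq> {}"
      using one by (auto simp: reduced_projectivities_def)
  next
    fix p assume "p \<in> reduced_projectivities d K \<sigma>"
    then obtain \<gamma> where p: "p = projectivity \<gamma>" and \<gamma>: "null_homotopic_facet_loop d K \<sigma> \<gamma>"
      by (auto simp: reduced_projectivities_def)
    have r: "null_homotopic_facet_loop d K \<sigma> (rev \<gamma>)" by (rule null_homotopic_rev[OF K \<gamma>])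
    have "compose \<sigma> (projectivity (rev \<gamma>)) (projectivity \<gamma>) = (\<lambda>v\<in>\<sigma>. v)"
      using projectivity_rev[OF K loop(1)[OF \<gamma>]] loop(2)[OF \<gamma>] by (auto simp: compose_def)
    then have "inv\<^bsub>BijGroup \<sigma>\<^esub> p = projectivity (rev \<gamma>)"
      using loop(4)[OF \<gamma>] loop(4)[OF r] p
      by (intro G.inv_equality) (simp_all add: BijGroup_mult BijGroup_simps)
    then show "inv\<^bsub>BijGroup \<sigma>\<^esub> p \<in> reduced_projectivities d K \<sigma>"
      using r by (auto simp: reduced_projectivities_def)
  next
    fix p q assume "p \<in> reduced_projectivities d K \<sigma>" "q \<in> reduced_projectivities d K \<sigma>"
    then obtain \<alpha> \<beta> where p: "p = projectivity \<alpha>" "q = projectivity \<beta>"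
      and \<alpha>: "null_homotopic_facet_loop d K \<sigma> \<alpha>" and \<beta>: "null_homotopic_facet_loop d K \<sigma> \<beta>"
      by (auto simp: reduced_projectivities_def)
    have "p \<otimes>\<^bsub>BijGroup \<sigma>\<^esub> q = projectivity (\<beta> @ tl \<alpha>)"
      using compose_projectivity[OF K loop(1)[OF \<beta>] loop(1)[OF \<alpha>]] loop[OF \<alpha>] loop[OF \<beta>] p
      by (simp add: BijGroup_mult)
    then show "p \<otimes>\<^bsub>BijGroup \<sigma>\<^esub> q \<in> reduced_projectivities d K \<sigma>"
      using null_homotopic_append[OF K \<beta> \<alpha>] by (auto simp: reduced_projectivities_def)
  qed
qed

lemma projectivities_around_subset_reduced:
  assumes K: "abstract_complex K" "pure_complex d K" and \<kappa>: "\<kappa> \<in> K"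
  shows "projectivities_around d K \<sigma>0 \<kappa> \<subseteq> reduced_projectivities d K \<sigma>0"
proof
  fix p assume "p \<in> projectivities_around d K \<sigma>0 \<kappa>"
  then obtain g l where p: "p = projectivity (g @ tl l @ tl (rev g))"
    and g: "facet_path d K g" "hd g = \<sigma>0" and l: "facet_loop d (star K \<kappa>) (last g) l"
    by (auto simp: projectivities_around_def)
  then show "p \<in> reduced_projectivities d K \<sigma>0"
    using null_homotopic_conjugate[OF K(1) g(1) null_homotopic_star_loop[OF K \<kappa> l]]
    unfolding reduced_projectivities_def by blast
qed

section \<open>Transport of cosets\<close>

definition push_coset :: "'a set \<Rightarrow> 'a set \<Rightarrow> 'a set \<Rightarrow> ('a \<Rightarrow> 'a) set \<Rightarrow> ('a \<Rightarrow> 'a) set" where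
  "push_coset \<sigma>0 \<sigma> \<tau> A = compose \<sigma>0 (perspectivity \<sigma> \<tau>) ` A"

text \<open>The fibre over \<open>\<sigma>\<close> of the covering that belongs to the subgroup \<open>N\<close>: the left cosets of \<open>N\<close> in the set of
projectivities along facet paths from \<open>\<sigma>0\<close> to \<open>\<sigma>\<close>.\<close>

definition cosets :: "nat \<Rightarrow> 'a set set \<Rightarrow> 'a set \<Rightarrow> ('a \<Rightarrow> 'a) set \<Rightarrow> 'a set \<Rightarrow> ('a \<Rightarrow> 'a) set set" where
  "cosets d K \<sigma>0 N \<sigma> =
     {compose \<sigma>0 (projectivity g) ` N |g. facet_path d K g \<and> hd g = \<sigma>0 \<and> last g = \<sigma>}"

lemma image_fixed: "(\<And>a. a \<in> A \<Longrightarrow> f a = a) \<Longrightarrow> f ` A = A"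
  by force

lemma transport_push_coset:
  assumes K: "abstract_complex K" and "facet_path d K \<gamma>" "A \<subseteq> (\<sigma>0 \<rightarrow> hd \<gamma>) \<inter> extensional \<sigma>0"
  shows "transport (push_coset \<sigma>0) \<gamma> A = compose \<sigma>0 (projectivity \<gamma>) ` A"
  using assms(2,3)
proof (induction \<gamma> arbitrary: A rule: projectivity.induct)
  case (2 \<sigma>)
  have "compose \<sigma>0 (\<lambda>v\<in>\<sigma>. v) a = a" if "a \<in> A" for a
  proof
    fix v show "compose \<sigma>0 (\<lambda>v\<in>\<sigma>. v) a v = a v"
      using 2 that by (cases "v \<in> \<sigma>0") (auto simp: compose_def extensional_def subset_iff Pi_iff)
  qed
  then have "compose \<sigma>0 (\<lambda>v\<in>\<sigma>. v) ` A = A" by (rule image_fixed)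
  then show ?case by (simp only: transport.simps projectivity.simps)
next
  case (3 \<sigma> \<tau> \<gamma>)
  have n: "neighbors d K \<sigma> \<tau>" using 3 by simp
  have "push_coset \<sigma>0 \<sigma> \<tau> A \<subseteq> (\<sigma>0 \<rightarrow> \<tau>) \<inter> extensional \<sigma>0"
    using 3(3) perspectivity_mem[OF K n] by (force simp: push_coset_def compose_def)
  then have "transport (push_coset \<sigma>0) (\<sigma> # \<tau> # \<gamma>) A =
      compose \<sigma>0 (projectivity (\<tau> # \<gamma>)) ` push_coset \<sigma>0 \<sigma> \<tau> A"
    using 3 by simp
  also have "\<dots> = compose \<sigma>0 (projectivity (\<sigma> # \<tau> # \<gamma>)) ` A"
    unfolding push_coset_def image_image
  proof (rule image_cong[OF refl])
    fix a assume "a \<in> A"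
    then have "a v \<in> \<sigma>" if "v \<in> \<sigma>0" for v using 3(3) that by auto
    then show "compose \<sigma>0 (projectivity (\<tau> # \<gamma>)) (compose \<sigma>0 (perspectivity \<sigma> \<tau>) a) =
        compose \<sigma>0 (projectivity (\<sigma> # \<tau> # \<gamma>)) a"
      by (auto simp: compose_def)
  qed
  finally show ?case .
qed auto

lemma coset_maps:
  assumes K: "abstract_complex K" and N: "N \<subseteq> Bij \<sigma>0" and A: "A \<in> cosets d K \<sigma>0 N \<sigma>"
  shows "A \<subseteq> (\<sigma>0 \<rightarrow> \<sigma>) \<inter> extensional \<sigma>0"
proof -
  obtain g where g: "A = compose \<sigma>0 (projectivity g) ` N" "facet_path d K g" "hd g = \<sigma>0" "last g = \<sigma>"
    using A by (auto simp: cosets_def)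
  have "n v \<in> \<sigma>0" if "n \<in> N" "v \<in> \<sigma>0" for n v using N that Bij_imp_funcset by blast
  then show ?thesis using projectivity_mem[OF K g(2)] g by (auto simp: compose_def)
qed

lemma facet_transport_cosets:
  assumes K: "abstract_complex K" "pure_complex d K" and N: "N \<subseteq> Bij \<sigma>0"
  shows "facet_transport d K (cosets d K \<sigma>0 N) (push_coset \<sigma>0)"
proof
  fix \<sigma> \<tau> A assume n: "neighbors d K \<sigma> \<tau>" and A: "A \<in> cosets d K \<sigma>0 N \<sigma>"
  obtain g where g: "A = compose \<sigma>0 (projectivity g) ` N" "facet_path d K g" "hd g = \<sigma>0" "last g = \<sigma>"
    using A by (auto simp: cosets_def)
  have st: "facet_path d K [\<sigma>, \<tau>]" using n by (auto simp: neighbors_def)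
  have nN: "n v \<in> \<sigma>0" if "n \<in> N" "v \<in> \<sigma>0" for n v using N that Bij_imp_funcset by blast
  have "push_coset \<sigma>0 \<sigma> \<tau> A = compose \<sigma>0 (projectivity (g @ tl [\<sigma>, \<tau>])) ` N"
    unfolding push_coset_def g(1) image_image
  proof (rule image_cong[OF refl])
    fix a assume a: "a \<in> N"
    have "perspectivity \<sigma> \<tau> (projectivity g v) = projectivity (g @ tl [\<sigma>, \<tau>]) v" if "v \<in> \<sigma>0" for v
    proof -
      have "projectivity g v \<in> \<sigma>" using projectivity_mem[OF K(1) g(2)] g(3,4) that by simp
      then show ?thesis
        using projectivity_append[OF K(1) g(2) st, of v] g(3,4) that perspectivity_mem[OF K(1) n]
        by (simp add: compose_def)
    qed
    then show "compose \<sigma>0 (perspectivity \<sigma> \<tau>) (compose \<sigma>0 (projectivity g) a) =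
        compose \<sigma>0 (projectivity (g @ tl [\<sigma>, \<tau>])) a"
      using nN[OF a] by (auto simp: compose_def)
  qed
  moreover have "facet_path d K (g @ tl [\<sigma>, \<tau>])" "hd (g @ tl [\<sigma>, \<tau>]) = \<sigma>0" "last (g @ tl [\<sigma>, \<tau>]) = \<tau>"
    using facet_path_append[OF g(2) st] hd_last_append_tl[of g "[\<sigma>, \<tau>]"] g(3,4) facet_path_nonempty[OF g(2)]
    by auto
  ultimately show "push_coset \<sigma>0 \<sigma> \<tau> A \<in> cosets d K \<sigma>0 N \<tau>" unfolding cosets_def by blast
  have "compose \<sigma>0 (perspectivity \<tau> \<sigma>) (compose \<sigma>0 (perspectivity \<sigma> \<tau>) a) = a" if "a \<in> A" for a
  proof
    fix v
    have "a \<in> \<sigma>0 \<rightarrow> \<sigma>" "a \<in> extensional \<sigma>0" using coset_maps[OF K(1) N A] that by auto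
    then show "compose \<sigma>0 (perspectivity \<tau> \<sigma>) (compose \<sigma>0 (perspectivity \<sigma> \<tau>) a) v = a v"
      using perspectivity_inverse[OF K(1) n]
      by (cases "v \<in> \<sigma>0") (auto simp: compose_def extensional_def)
  qed
  then show "push_coset \<sigma>0 \<tau> \<sigma> (push_coset \<sigma>0 \<sigma> \<tau> A) = A"
    unfolding push_coset_def image_image by (rule image_fixed)
qed (rule K)+

lemma subgroup_translate:
  assumes "group G" "subgroup N G" "m \<in> N"
  shows "(\<lambda>n. m \<otimes>\<^bsub>G\<^esub> n) ` N = N"
  using group.coset_join3[OF assms(1) subgroup.mem_carrier[OF assms(2,3)] assms(2,3)]
  by (simp add: l_coset_def UNION_singleton_eq_range)

text \<open>Let \<open>p\<close> be the projectivity of \<open>g\<close> and \<open>q\<close> that of a loop \<open>l\<close> around an odd face.  Then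
\<open>q \<circ> p = p \<circ> m\<close>, where \<open>m\<close> is the projectivity of \<open>g l g\<^sup>-\<close> and so lies in \<open>N\<close>; hence \<open>l\<close> fixes the coset
\<open>p \<circ> N\<close>.  In all other cases \<open>q\<close> itself is trivial.\<close>

lemma flat_cosets:
  assumes K: "abstract_complex K" "pure_complex d K"
    and N: "subgroup N (BijGroup \<sigma>0)"
    and odd: "\<And>\<kappa>. \<kappa> \<in> K \<Longrightarrow> codim d \<kappa> = 2 \<Longrightarrow> odd_face K \<kappa> \<Longrightarrow> projectivities_around d K \<sigma>0 \<kappa> \<subseteq> N"
    and \<kappa>: "\<kappa> \<in> K" "codim d \<kappa> \<le> 2"
  shows "facet_transport.flat_at d K (cosets d K \<sigma>0 N) (push_coset \<sigma>0) \<kappa>"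
proof -
  have NB: "N \<subseteq> Bij \<sigma>0" using subgroup.subset[OF N] by (simp add: BijGroup_simps)
  interpret facet_transport d K "cosets d K \<sigma>0 N" "push_coset \<sigma>0"
    by (rule facet_transport_cosets[OF K NB])
  show ?thesis unfolding flat_at_def
  proof (intro allI ballI impI)
    fix l A assume A: "A \<in> cosets d K \<sigma>0 N (hd l)" and l: "facet_loop d (star K \<kappa>) (hd l) l"
    note lK = star_loop_projectivity[OF K l]
    have lp: "facet_path d K l" "last l = hd l" using lK(1) by (auto simp: facet_loop_def)
    have Amaps: "a \<in> \<sigma>0 \<rightarrow> hd l" "a \<in> extensional \<sigma>0" if "a \<in> A" for a
      using coset_maps[OF K(1) NB A] that by auto
    have tr: "transport (push_coset \<sigma>0) l A = compose \<sigma>0 (projectivity l) ` A"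
      by (rule transport_push_coset[OF K(1) lp(1) coset_maps[OF K(1) NB A]])
    show "transport (push_coset \<sigma>0) l A = A"
    proof (cases "codim d \<kappa> = 2 \<and> odd_face K \<kappa>")
      case False
      have "projectivity l v = v" if "v \<in> hd l" for v
      proof (cases "codim d \<kappa> = 2")
        case True then show ?thesis using projectivity_even[OF K \<kappa>(1) _ _ l that] False by simp
      next
        case False then show ?thesis using projectivity_codim_le_1[OF K \<kappa>(1) _ l that] \<kappa>(2) by simp
      qed
      then have "compose \<sigma>0 (projectivity l) a = a" if "a \<in> A" for a
        using Amaps[OF that] by (auto simp: compose_def extensional_def fun_eq_iff)
      then show ?thesis unfolding tr by (rule image_fixed)
    next
      case True
      obtain g where g: "A = compose \<sigma>0 (projectivity g) ` N" "facet_path d K g" "hd g = \<sigma>0" "last g = hd l"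
        using A by (auto simp: cosets_def)
      let ?m = "projectivity (g @ tl l @ tl (rev g))"
      have l': "facet_loop d (star K \<kappa>) (last g) l" "facet_loop d K (last g) l" using l lK(1) g(4) by auto
      have "?m \<in> projectivities_around d K \<sigma>0 \<kappa>"
        unfolding projectivities_around_def using g l' lK(2)
        by (intro CollectI exI[of _ g] exI[of _ l]) auto
      then have m: "?m \<in> N" using odd \<kappa>(1) True by blast
      have eq: "projectivity l (projectivity g v) = projectivity g (?m v)" if "v \<in> \<sigma>0" for v
      proof -
        have w: "projectivity l (projectivity g v) \<in> hd (rev g)"
          using projectivity_mem[OF K(1) g(2), of v] projectivity_mem[OF K(1) lp(1)] that g(3,4) lp(2)
            facet_path_nonempty[OF g(2)] by (simp add: hd_rev)
        show ?thesis
          using projectivity_rev[OF K(1) facet_path_rev[OF g(2)] w]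
            projectivity_conjugate[OF K(1) g(2) l'(2), of v] that g(3) by simp
      qed
      have "transport (push_coset \<sigma>0) l A = (\<lambda>n. compose \<sigma>0 (projectivity g) (?m \<otimes>\<^bsub>BijGroup \<sigma>0\<^esub> n)) ` N"
        unfolding tr unfolding g(1) image_image
      proof (rule image_cong[OF refl])
        fix n assume n: "n \<in> N"
        then have "n v \<in> \<sigma>0" if "v \<in> \<sigma>0" for v using NB that Bij_imp_funcset by blast
        then show "compose \<sigma>0 (projectivity l) (compose \<sigma>0 (projectivity g) n) =
            compose \<sigma>0 (projectivity g) (?m \<otimes>\<^bsub>BijGroup \<sigma>0\<^esub> n)"
          using m n NB eq by (subst BijGroup_mult) (auto simp: compose_def)
      qed
      also have "\<dots> = compose \<sigma>0 (projectivity g) ` (\<lambda>n. ?m \<otimes>\<^bsub>BijGroup \<sigma>0\<^esub> n) ` N"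
        by (simp add: image_image)
      also have "\<dots> = A"
        unfolding subgroup_translate[OF group_BijGroup N m] g(1) ..
      finally show ?thesis .
    qed
  qed
qed

text \<open>Transport along a null-homotopic loop \<open>\<gamma>\<close> fixes the coset \<open>N\<close> of the trivial path, and it sends the
identity in \<open>N\<close> to the projectivity of \<open>\<gamma>\<close>.\<close>

lemma reduced_projectivities_subset:
  assumes K: "abstract_complex K" "pure_complex d K" and nice: "nice_complex d K"
    and \<sigma>0: "\<sigma>0 \<in> facets d K" and N: "subgroup N (BijGroup \<sigma>0)"
    and odd: "\<And>\<kappa>. \<kappa> \<in> K \<Longrightarrow> codim d \<kappa> = 2 \<Longrightarrow> odd_face K \<kappa> \<Longrightarrow> projectivities_around d K \<sigma>0 \<kappa> \<subseteq> N"
  shows "reduced_projectivities d K \<sigma>0 \<subseteq> N"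
proof
  fix p assume "p \<in> reduced_projectivities d K \<sigma>0"
  then obtain \<gamma> where p: "p = projectivity \<gamma>" and \<gamma>: "null_homotopic_facet_loop d K \<sigma>0 \<gamma>"
    by (auto simp: reduced_projectivities_def)
  have \<gamma>': "facet_path d K \<gamma>" "hd \<gamma> = \<sigma>0" "last \<gamma> = \<sigma>0" "facet_loop d K \<sigma>0 \<gamma>"
    using \<gamma> by (auto simp: null_homotopic_facet_loop_def facet_loop_def)
  have NB: "N \<subseteq> Bij \<sigma>0" using subgroup.subset[OF N] by (simp add: BijGroup_simps)
  interpret facet_transport d K "cosets d K \<sigma>0 N" "push_coset \<sigma>0"
    by (rule facet_transport_cosets[OF K NB])
  have NBs: "N \<subseteq> (\<sigma>0 \<rightarrow> \<sigma>0) \<inter> extensional \<sigma>0"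
    using NB Bij_imp_funcset Bij_imp_extensional by blast
  have id: "compose \<sigma>0 (projectivity [\<sigma>0]) ` N = N"
    using transport_push_coset[OF K(1), of d "[\<sigma>0]" N \<sigma>0] \<sigma>0 NBs by simp
  have "\<exists>g. N = compose \<sigma>0 (projectivity g) ` N \<and> facet_path d K g \<and> hd g = \<sigma>0 \<and> last g = \<sigma>0"
    using id \<sigma>0 by (intro exI[of _ "[\<sigma>0]"]) simp
  then have "N \<in> cosets d K \<sigma>0 N \<sigma>0" unfolding cosets_def by blast
  from transport_null_homotopic_nice[OF nice flat_cosets[OF K N odd] \<gamma> this]
  have "transport (push_coset \<sigma>0) \<gamma> N = N" by blast
  then have "compose \<sigma>0 (projectivity \<gamma>) ` N = N"
    using transport_push_coset[OF K(1) \<gamma>'(1)] NBs \<gamma>'(2) by simp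
  moreover have "(\<lambda>v\<in>\<sigma>0. v) \<in> N" using subgroup.one_closed[OF N] by (simp add: BijGroup_simps)
  ultimately have "compose \<sigma>0 (projectivity \<gamma>) (\<lambda>v\<in>\<sigma>0. v) \<in> N" by blast
  moreover have "compose \<sigma>0 (projectivity \<gamma>) (\<lambda>v\<in>\<sigma>0. v) = projectivity \<gamma>"
    using projectivity_loop_Bij[OF K(1) \<gamma>'(4)] by (auto simp: Bij_def compose_def extensional_def)
  ultimately show "p \<in> N" using p by simp
qed

section \<open>Generators of the reduced group\<close>

theorem theorem3p2p2:
  fixes K :: "'a set set" and d :: nat and \<sigma>0 :: "'a set"
  assumes "abstract_complex K" and "locally_finite_complex K" and "pure_complex d K"
    and "nice_complex d K" and "\<sigma>0 \<in> facets d K"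
  shows "reduced_projectivities d K \<sigma>0 =
      generate (BijGroup \<sigma>0)
        (\<Union>\<kappa>\<in>{\<kappa>\<in>K. codim d \<kappa> = 2 \<and> odd_face K \<kappa>}. projectivities_around d K \<sigma>0 \<kappa>)
    \<and> (\<exists>T \<subseteq> transpositions \<sigma>0. reduced_projectivities d K \<sigma>0 = generate (BijGroup \<sigma>0) T)"
proof -
  note K = assms(1,3)
  interpret G: group "BijGroup \<sigma>0" by (rule group_BijGroup)
  let ?R = "reduced_projectivities d K \<sigma>0"
  let ?S = "\<Union>\<kappa>\<in>{\<kappa>\<in>K. codim d \<kappa> = 2 \<and> odd_face K \<kappa>}. projectivities_around d K \<sigma>0 \<kappa>"
  let ?T = "?S \<inter> transpositions \<sigma>0"
  have R: "subgroup ?R (BijGroup \<sigma>0)" by (rule reduced_projectivities_subgroup[OF K(1) assms(5)])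
  have SR: "?S \<subseteq> ?R" using projectivities_around_subset_reduced[OF K] by blast
  then have SG: "?S \<subseteq> carrier (BijGroup \<sigma>0)" using subgroup.subset[OF R] by blast
  have TG: "?T \<subseteq> carrier (BijGroup \<sigma>0)" using SG by blast
  have eq: "?R = generate (BijGroup \<sigma>0) ?S"
  proof
    show "generate (BijGroup \<sigma>0) ?S \<subseteq> ?R" by (rule G.generate_subgroup_incl[OF SR R])
    have "projectivities_around d K \<sigma>0 \<kappa> \<subseteq> generate (BijGroup \<sigma>0) ?S"
      if "\<kappa> \<in> K" "codim d \<kappa> = 2" "odd_face K \<kappa>" for \<kappa>
      using that by (blast intro: generate.incl)
    then show "?R \<subseteq> generate (BijGroup \<sigma>0) ?S"
      by (rule reduced_projectivities_subset[OF K assms(4,5) G.generate_is_subgroup[OF SG]])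
  qed
  have "?S \<subseteq> generate (BijGroup \<sigma>0) ?T"
  proof
    fix p assume p: "p \<in> ?S"
    then have "p = \<one>\<^bsub>BijGroup \<sigma>0\<^esub> \<or> p \<in> transpositions \<sigma>0"
      using projectivities_around_transpositions[OF K] by (auto simp: BijGroup_simps)
    then show "p \<in> generate (BijGroup \<sigma>0) ?T"
      using p generate.one[of "BijGroup \<sigma>0" ?T] generate.incl[of p ?T "BijGroup \<sigma>0"] by blast
  qed
  then have "generate (BijGroup \<sigma>0) ?S \<subseteq> generate (BijGroup \<sigma>0) ?T"
    by (rule G.generate_subgroup_incl[OF _ G.generate_is_subgroup[OF TG]])
  moreover have "generate (BijGroup \<sigma>0) ?T \<subseteq> generate (BijGroup \<sigma>0) ?S"
    by (rule G.mono_generate) blast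
  ultimately have "?R = generate (BijGroup \<sigma>0) ?T" using eq by simp
  moreover have "?T \<subseteq> transpositions \<sigma>0" by blast
  ultimately show ?thesis using eq by blast
qed

end
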